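(* Let $\mathcal{T}$ be a forest with components $T_1,T_2,\ldots,T_n$, such that each $T_i$ is a perfect tree. Let $T_1,\ldots,T_m$ be exactly those components whose arity is the highest among the arities of $T_1,\ldots,T_n$, let $h_i$ be the number of levels of $T_i$ for $i\in[m]$, and suppose $h_1\le h_2\le\cdots\le h_m$. If $h_i$ is even for every $i\in[m]$, let $\ell$ be any leaf of $T_m$; otherwise, let $j\in[m]$ be minimal such that $h_j$ is odd, and let $\ell$ be any leaf of $T_j$. Then for every positive integer $k$ and every $v\in V(\mathcal{T})$, $|\mathcal{I}_{\mathcal{T}}^k(v)|\le|\mathcal{I}_{\mathcal{T}}^k(\ell)|$.
   Context: For an integer $r\ge 2$, the perfect $r$-ary tree with $h$ levels is the rooted tree in which every non-leaf vertex has exactly $r$ children and which has exactly $r^{h-1}$ leaves, all at distance $h-1$ from the root; its arity is $r$, and its leaves are the vertices at distance $h-1$ from the root. A perfect tree is a perfect $r$-ary tree for some $r\ge2$. For a graph $G$, a set $I\subseteq V(G)$ is independent if no two vertices of $I$ are adjacent; $\mathcal{I}_G^k$ denotes the family of all independent sets of size $k$ in $G$, and for $v\in V(G)$, $\mathcal{I}_G^k(v)=\{A\in\mathcal{I}_G^k : v\in A\}$.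
   Formalization: A one-vertex component is perfect r-ary for every r ≥ 2, so its arity is ambiguous; it is always counted among the components of highest arity, since giving it a lower arity makes the claim false (K_1 with K_{1,3}, k = 2). *)

theory Defs
  imports Main
begin

text \<open>
  Simple graphs are developed from scratch: the trees and forests of the AFP entry Graph_Theory
  are those of digraphs, where both orientations of one edge already form a cycle.
\<close>

datatype 'a sgraph = SGraph (verts: "'a set") (edges: "'a set set")

definition simple_graph :: "'a sgraph \<Rightarrow> bool" where
  "simple_graph G \<longleftrightarrow> finite (verts G) \<and> (\<forall>e \<in> edges G. e \<subseteq> verts G \<and> card e = 2)"

definition adj :: "'a sgraph \<Rightarrow> 'a \<Rightarrow> 'a \<Rightarrow> bool" where
  "adj G u v \<longleftrightarrow> {u, v} \<in> edges G"

definition subgraph :: "'a sgraph \<Rightarrow> 'a sgraph \<Rightarrow> bool" where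
  "subgraph H G \<longleftrightarrow> simple_graph H \<and> verts H \<subseteq> verts G \<and> edges H \<subseteq> edges G"

definition walk :: "'a sgraph \<Rightarrow> 'a list \<Rightarrow> bool" where
  "walk G p \<longleftrightarrow> p \<noteq> [] \<and> set p \<subseteq> verts G \<and> successively (adj G) p"

definition graph_connected :: "'a sgraph \<Rightarrow> bool" where
  "graph_connected G \<longleftrightarrow>
     verts G \<noteq> {} \<and> (\<forall>u \<in> verts G. \<forall>v \<in> verts G. \<exists>p. walk G p \<and> hd p = u \<and> last p = v)"

definition graph_cycle :: "'a sgraph \<Rightarrow> 'a list \<Rightarrow> bool" where
  "graph_cycle G p \<longleftrightarrow> walk G p \<and> distinct p \<and> length p \<ge> 3 \<and> adj G (last p) (hd p)"

definition graph_forest :: "'a sgraph \<Rightarrow> bool" where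
  "graph_forest G \<longleftrightarrow> simple_graph G \<and> (\<nexists>p. graph_cycle G p)"

definition graph_tree :: "'a sgraph \<Rightarrow> bool" where
  "graph_tree G \<longleftrightarrow> graph_forest G \<and> graph_connected G"

definition graph_components :: "'a sgraph \<Rightarrow> 'a sgraph set" where
  "graph_components G =
     {H. subgraph H G \<and> graph_connected H \<and>
         (\<forall>H'. subgraph H' G \<and> graph_connected H' \<and> subgraph H H' \<longrightarrow> H' = H)}"

text \<open>Only meaningful for vertices joined by a walk.\<close>

definition graph_dist :: "'a sgraph \<Rightarrow> 'a \<Rightarrow> 'a \<Rightarrow> nat" where
  "graph_dist G u v = (LEAST d. \<exists>p. walk G p \<and> hd p = u \<and> last p = v \<and> length p = Suc d)"

definition children :: "'a sgraph \<Rightarrow> 'a \<Rightarrow> 'a \<Rightarrow> 'a set" where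
  "children G \<rho> v = {w \<in> verts G. adj G v w \<and> graph_dist G \<rho> w = Suc (graph_dist G \<rho> v)}"

definition leaves :: "'a sgraph \<Rightarrow> 'a \<Rightarrow> 'a set" where
  "leaves G \<rho> = {v \<in> verts G. children G \<rho> v = {}}"

text \<open>
  \<open>perfect_tree G \<rho> r h\<close>: the tree \<open>G\<close> with root \<open>\<rho>\<close> is the perfect \<open>r\<close>-ary tree with \<open>h\<close> levels.
  For \<open>h \<ge> 2\<close> the arity \<open>r\<close> is determined by \<open>G\<close>.  The tree with \<open>h = 1\<close> is a single vertex and
  is perfect \<open>r\<close>-ary for every \<open>r \<ge> 2\<close>, so ``has arity \<open>r\<close>'' is a relation and not a function.
\<close>

definition perfect_tree :: "'a sgraph \<Rightarrow> 'a \<Rightarrow> nat \<Rightarrow> nat \<Rightarrow> bool" where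
  "perfect_tree G \<rho> r h \<longleftrightarrow>
     graph_tree G \<and> \<rho> \<in> verts G \<and> r \<ge> 2 \<and> h \<ge> 1 \<and>
     (\<forall>v \<in> verts G - leaves G \<rho>. card (children G \<rho> v) = r) \<and>
     card (leaves G \<rho>) = r ^ (h - 1) \<and>
     leaves G \<rho> = {v \<in> verts G. graph_dist G \<rho> v = h - 1}"

definition indep_sets :: "'a sgraph \<Rightarrow> nat \<Rightarrow> 'a set set" where
  "indep_sets G k = {A. A \<subseteq> verts G \<and> card A = k \<and> pairwise (\<lambda>u w. \<not> adj G u w) A}"

definition indep_star :: "'a sgraph \<Rightarrow> nat \<Rightarrow> 'a \<Rightarrow> 'a set set" where
  "indep_star G k v = {A \<in> indep_sets G k. v \<in> A}"

end

theory Submission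
  imports Defs "HOL-Computational_Algebra.Polynomial" "HOL-Library.Disjoint_Sets"
begin

text \<open>
  Count independent sets by polynomials in \<open>X\<close> and compare polynomials coefficientwise.  Let \<open>P h\<close> count
  the independent sets of the perfect \<open>r\<close>-ary tree with \<open>h\<close> levels, and let \<open>S h\<close> count those that
  contain a given leaf.  Both satisfy the recursion
  \<open>Z (h + 2) = P (h + 1) ^ (r - 1) * Z (h + 1) + X * P h ^ (r\<^sup>2 - 1) * Z h\<close>, so that \<open>S h / P h\<close> behaves
  like the convergents of a continued fraction: \<open>S h * P h' - S h' * P h\<close> with \<open>h < h'\<close> has a sign that
  depends on the parity of \<open>h\<close> only.  Hence the shortest odd tree, or else the tallest even tree, is
  best.  For arities \<open>s < r\<close> the same recursion reduces the comparison to trees with at most three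
  levels.

  Within one tree, the recursion reduces an arbitrary vertex to the root of its own subtree.  For
  root against leaf, exchange the two ends of the path joining them: the subtrees
  hanging off the path contribute a weight to each vertex, and which of two vertices at mirror
  positions gains by a swap alternates along the path, just as a chain of forced swaps does.
\<close>

section \<open>Coefficientwise comparison of polynomials\<close>

text \<open>Integer coefficients, although everything counts sets: the order is defined by a
  difference, and cross products of ratios have to be subtracted.\<close>

definition cnonneg :: "int poly \<Rightarrow> bool" where
  "cnonneg p \<longleftrightarrow> (\<forall>i. 0 \<le> coeff p i)"

definition cle :: "int poly \<Rightarrow> int poly \<Rightarrow> bool" (infix "\<preceq>" 50) where
  "p \<preceq> q \<longleftrightarrow> cnonneg (q - p)"

definition X :: "int poly" where
  "X = [:0, 1:]"

lemma cnonneg_0 [simp]: "cnonneg 0"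
  by (simp add: cnonneg_def)

lemma cnonneg_1 [simp]: "cnonneg 1"
  by (simp add: cnonneg_def coeff_1)

lemma cnonneg_X [simp]: "cnonneg X"
  by (simp add: X_def cnonneg_def coeff_pCons split: nat.split)

lemma cnonneg_monom [simp]: "0 \<le> c \<Longrightarrow> cnonneg (monom c n)"
  by (simp add: cnonneg_def)

lemma cnonneg_add [simp]: "cnonneg p \<Longrightarrow> cnonneg q \<Longrightarrow> cnonneg (p + q)"
  by (simp add: cnonneg_def)

lemma cnonneg_mult [simp]: "cnonneg p \<Longrightarrow> cnonneg q \<Longrightarrow> cnonneg (p * q)"
  by (simp add: cnonneg_def coeff_mult sum_nonneg)

lemma cnonneg_power [simp]: "cnonneg p \<Longrightarrow> cnonneg (p ^ n)"
  by (induction n) auto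

lemma cnonneg_sum: "(\<And>i. i \<in> I \<Longrightarrow> cnonneg (f i)) \<Longrightarrow> cnonneg (\<Sum>i\<in>I. f i)"
  by (induction I rule: infinite_finite_induct) auto

lemma cnonneg_prod: "(\<And>i. i \<in> I \<Longrightarrow> cnonneg (f i)) \<Longrightarrow> cnonneg (\<Prod>i\<in>I. f i)"
  by (induction I rule: infinite_finite_induct) auto

lemma cle_coeff: "p \<preceq> q \<Longrightarrow> coeff p i \<le> coeff q i"
  by (simp add: cle_def cnonneg_def)

lemma cle_refl [simp]: "p \<preceq> p"
  by (simp add: cle_def)

lemma cle_trans [trans]: "p \<preceq> q \<Longrightarrow> q \<preceq> s \<Longrightarrow> p \<preceq> s"
  unfolding cle_def cnonneg_def by (simp, meson order_trans)

lemma zero_cle [simp]: "0 \<preceq> p \<longleftrightarrow> cnonneg p"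
  by (simp add: cle_def)

lemma cle_add: "p \<preceq> q \<Longrightarrow> p' \<preceq> q' \<Longrightarrow> p + p' \<preceq> q + q'"
  unfolding cle_def cnonneg_def by (simp add: add_mono)

lemma cle_mult_left: "p \<preceq> q \<Longrightarrow> cnonneg c \<Longrightarrow> c * p \<preceq> c * q"
  unfolding cle_def by (metis cnonneg_mult right_diff_distrib)

lemma cle_mult:
  assumes "p \<preceq> q" "p' \<preceq> q'" "cnonneg p" "cnonneg q'"
  shows "p * p' \<preceq> q * q'"
proof -
  have "p * p' \<preceq> p * q'"
    using assms by (intro cle_mult_left)
  also have "p * q' \<preceq> q * q'"
    using cle_mult_left[OF assms(1,4)] by (simp add: mult.commute)
  finally show ?thesis .
qed

lemma cnonneg_cle: "cnonneg p \<Longrightarrow> p \<preceq> q \<Longrightarrow> cnonneg q"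
  using cle_trans zero_cle by blast

lemma cle_power: "p \<preceq> q \<Longrightarrow> cnonneg p \<Longrightarrow> p ^ n \<preceq> q ^ n"
  by (induction n) (auto intro!: cle_mult dest: cnonneg_cle)

lemma one_cle_power: "1 \<preceq> p \<Longrightarrow> 1 \<preceq> p ^ n"
  using cle_power[of 1 p n] by simp

section \<open>Recursions for perfect trees\<close>

text \<open>Truncated subtraction is harmless in the recursions, as \<open>tree_poly r 0 = 1\<close>.\<close>

fun tree_poly :: "nat \<Rightarrow> nat \<Rightarrow> int poly" where
  "tree_poly r 0 = 1"
| "tree_poly r (Suc t) = tree_poly r t ^ r + X * tree_poly r (t - 1) ^ r\<^sup>2"

text \<open>\<open>g\<close> is the level of the marked vertex counted from the leaves, so a leaf
  has \<open>g = 1\<close>. The value 0 for heights below \<open>g\<close> is what the recursion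
  needs at height \<open>g + 1\<close>: there the marked vertex is a child of the root, and choosing
  the root excludes it.\<close>

fun star_poly :: "nat \<Rightarrow> nat \<Rightarrow> nat \<Rightarrow> int poly" where
  "star_poly r g 0 = 0"
| "star_poly r g (Suc h) =
     (if Suc h < g then 0
      else if Suc h = g then X * tree_poly r (g - 2) ^ r\<^sup>2
      else tree_poly r h ^ (r - 1) * star_poly r g h
           + X * tree_poly r (h - 1) ^ (r\<^sup>2 - 1) * star_poly r g (h - 1))"

lemma cnonneg_tree_poly [simp]: "cnonneg (tree_poly r t)"
  by (induction r t rule: tree_poly.induct) auto

lemma cnonneg_star_poly [simp]: "cnonneg (star_poly r g h)"
  by (induction r g h rule: star_poly.induct) auto

text \<open>
  Weights of a vertex on the path from the root to a leaf, when its \<open>r - 1\<close> children off the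
  path carry perfect trees with \<open>t\<close> levels.
\<close>

definition out_wt :: "nat \<Rightarrow> nat \<Rightarrow> int poly" where
  "out_wt r t = tree_poly r t ^ (r - 1)"

definition in_wt :: "nat \<Rightarrow> nat \<Rightarrow> int poly" where
  "in_wt r t = X * tree_poly r (t - 1) ^ (r * (r - 1))"

lemma cnonneg_wt [simp]: "cnonneg (out_wt r t)" "cnonneg (in_wt r t)"
  by (auto simp: out_wt_def in_wt_def)

lemma in_wt_0 [simp]: "in_wt r 0 = X"
  by (simp add: in_wt_def)

lemma in_out_wt:
  assumes "0 < r"
  shows "in_wt r (Suc t) * out_wt r t = X * tree_poly r t ^ (r\<^sup>2 - 1)"
proof -
  have "r * (r - 1) + (r - 1) = r\<^sup>2 - 1"
    using assms by (cases r) (auto simp: power2_eq_square)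
  then show ?thesis
    by (simp add: in_wt_def out_wt_def flip: power_add)
qed

text \<open>\<open>star_poly_rec\<close> has the same linear three-term form with the same
  coefficients. This lets an inequality between cross products pass from two consecutive heights to
  all larger ones.\<close>

lemma tree_poly_rec:
  assumes "0 < r"
  shows "tree_poly r (Suc (Suc t)) =
    out_wt r (Suc t) * tree_poly r (Suc t) + in_wt r (Suc t) * out_wt r t * tree_poly r t"
proof -
  have "p ^ (k - 1) * p = p ^ k" if "0 < k" for p :: "int poly" and k
    using that by (cases k) auto
  then have "out_wt r (Suc t) * tree_poly r (Suc t) = tree_poly r (Suc t) ^ r"
    "tree_poly r t ^ (r\<^sup>2 - 1) * tree_poly r t = tree_poly r t ^ r\<^sup>2"
    using assms by (auto simp: out_wt_def simp del: tree_poly.simps)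
  then show ?thesis
    by (simp only: tree_poly.simps(2)[of r "Suc t"] in_out_wt[OF assms] mult.assoc diff_Suc_1)
qed

lemma star_poly_rec:
  assumes "0 < r" "g \<le> Suc t"
  shows "star_poly r g (Suc (Suc t)) =
    out_wt r (Suc t) * star_poly r g (Suc t) + in_wt r (Suc t) * out_wt r t * star_poly r g t"
proof -
  have "\<not> Suc (Suc t) < g" "Suc (Suc t) \<noteq> g" using assms by auto
  then show ?thesis
    by (simp only: star_poly.simps(2)[of r g "Suc t"] in_out_wt[OF assms(1)] out_wt_def[of r "Suc t"]
        if_False diff_Suc_1)
qed

text \<open>In terms of \<open>f t = tree_poly r t / tree_poly r (t - 1) ^ r\<close> the recursion
  reads \<open>f (t + 1) = 1 + X / f t ^ r\<close>. This map reverses the order and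
  \<open>f 0 = 1\<close> lies below all later values, so whether \<open>f s\<close> lies below or
  above the later values alternates with \<open>s\<close>.\<close>

lemma tree_poly_parity:
  assumes "s < t"
  shows "if even s
         then tree_poly r (t - 1) ^ r * tree_poly r s \<preceq> tree_poly r t * tree_poly r (s - 1) ^ r
         else tree_poly r t * tree_poly r (s - 1) ^ r \<preceq> tree_poly r (t - 1) ^ r * tree_poly r s"
  using assms
proof (induction s arbitrary: t)
  case 0
  then obtain u where "t = Suc u" by (cases t) auto
  then show ?case by (simp add: cle_def)
next
  case (Suc s)
  then obtain u where t: "t = Suc u" "s < u" by (cases t) auto
  let ?p = "tree_poly r"
  define a b where "a = ?p (u - 1) ^ r * ?p s" and "b = ?p u * ?p (s - 1) ^ r"
  have "?p t = ?p u ^ r + X * (?p (u - 1) ^ r) ^ r" "?p (Suc s) = ?p s ^ r + X * (?p (s - 1) ^ r) ^ r"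
    by (simp_all add: t power2_eq_square flip: power_mult)
  \<comment> \<open>The leading terms cancel; what remains compares \<open>r\<close>-th powers of
    the two sides for \<open>s\<close> and \<open>u\<close>, with the order reversed.\<close>
  then have eq: "?p t * ?p (Suc s - 1) ^ r - ?p (t - 1) ^ r * ?p (Suc s) = X * (a ^ r - b ^ r)"
    by (simp only: t a_def b_def power_mult_distrib diff_Suc_1) (simp only: algebra_simps)
  then have "?p (t - 1) ^ r * ?p (Suc s) - ?p t * ?p (Suc s - 1) ^ r = X * (b ^ r - a ^ r)"
    by (metis minus_diff_eq mult_minus_right)
  moreover have "if even s then a \<preceq> b else b \<preceq> a"
    using Suc.IH[OF t(2)] by (simp only: a_def b_def)
  then have "if even s then a ^ r \<preceq> b ^ r else b ^ r \<preceq> a ^ r"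
    by (auto intro!: cle_power simp: a_def b_def split: if_splits)
  ultimately show ?case
    using eq by (simp add: cle_def del: tree_poly.simps split: if_splits)
qed

text \<open>Up to the factor \<open>X\<close> these are the sides of \<open>tree_poly_parity\<close>
  raised to the power \<open>r - 1\<close>, the number of children off the path.\<close>

lemma wt_parity:
  assumes "s < t"
  shows "if even s then in_wt r t * out_wt r s \<preceq> out_wt r t * in_wt r s
         else out_wt r t * in_wt r s \<preceq> in_wt r t * out_wt r s"
proof -
  let ?p = "tree_poly r"
  have 1: "in_wt r t * out_wt r s = X * (?p (t - 1) ^ r * ?p s) ^ (r - 1)"
    unfolding in_wt_def out_wt_def power_mult power_mult_distrib by (simp only: mult_ac)
  have 2: "out_wt r t * in_wt r s = X * (?p t * ?p (s - 1) ^ r) ^ (r - 1)"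
    unfolding in_wt_def out_wt_def power_mult power_mult_distrib by (simp only: mult_ac)
  show ?thesis
    unfolding 1 2 using tree_poly_parity[OF assms, of r]
    by (auto intro!: cle_mult_left cle_power split: if_splits)
qed

section \<open>Exchanging the ends of a weighted path\<close>

text \<open>
  \<open>seg s d\<close> sums, over the independent subsets of the path \<open>s, \<dots>, s + d - 1\<close>, the products of the
  weights \<open>b\<close> of chosen and \<open>a\<close> of unchosen vertices; \<open>lo_out\<close> and \<open>hi_out\<close> force the lowest and the
  highest vertex to be unchosen.
\<close>

context
  fixes a b :: "nat \<Rightarrow> int poly"
begin

fun seg :: "nat \<Rightarrow> nat \<Rightarrow> int poly" and lo_out :: "nat \<Rightarrow> nat \<Rightarrow> int poly" where
  "seg s 0 = 1"
| "seg s (Suc d) = a s * seg (Suc s) d + b s * lo_out (Suc s) d"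
| "lo_out s 0 = 1"
| "lo_out s (Suc d) = a s * seg (Suc s) d"

fun hi_out :: "nat \<Rightarrow> nat \<Rightarrow> int poly" where
  "hi_out s 0 = 1"
| "hi_out s (Suc d) = seg s d * a (s + d)"

text \<open>Both sides describe the path \<open>s, ..., s + d\<close> with its two ends
  unchosen.\<close>

lemma lo_hi_out: "lo_out s d * a (s + d) = a s * hi_out (Suc s) d"
  by (cases d) (simp_all add: mult.assoc)

text \<open>\<open>seg\<close> is defined by unfolding at the lowest vertex; unfolding at the
  highest one makes it possible to peel off both ends. The induction takes two steps because a
  chosen vertex also decides its neighbour.\<close>

lemma seg_Suc_hi: "seg s (Suc d) = a (s + d) * seg s d + b (s + d) * hi_out s d"
proof (induction d arbitrary: s rule: induct_nat_012)
  case 0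
  then show ?case by simp
next
  case 1
  then show ?case by (simp add: algebra_simps)
next
  case (ge2 d)
  have "seg s (Suc (Suc (Suc d))) = a s * seg (Suc s) (Suc (Suc d)) + b s * (a (Suc s) * seg (Suc (Suc s)) (Suc d))"
    by (simp only: seg.simps lo_out.simps)
  also have "\<dots> = a (s + Suc (Suc d)) * (a s * seg (Suc s) (Suc d) + b s * (a (Suc s) * seg (Suc (Suc s)) d))
      + b (s + Suc (Suc d)) * (a s * hi_out (Suc s) (Suc d) + b s * (a (Suc s) * hi_out (Suc (Suc s)) d))"
    by (simp only: ge2.IH add_Suc_right add_Suc) (simp only: algebra_simps)
  also have "a s * seg (Suc s) (Suc d) + b s * (a (Suc s) * seg (Suc (Suc s)) d) = seg s (Suc (Suc d))"
    by (simp only: seg.simps lo_out.simps)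
  also have "a s * hi_out (Suc s) (Suc d) + b s * (a (Suc s) * hi_out (Suc (Suc s)) d) = hi_out s (Suc (Suc d))"
    by (simp only: lo_hi_out[symmetric] hi_out.simps seg.simps add_Suc_right add_Suc)
      (simp only: algebra_simps)
  finally show ?case .
qed

lemma lo_out_Suc_hi: "lo_out s (Suc (Suc d)) = a (s + Suc d) * lo_out s (Suc d) + b (s + Suc d) * a s * hi_out (Suc s) d"
  by (simp only: lo_out.simps seg_Suc_hi add_Suc_right add_Suc) (simp only: algebra_simps)

context
  assumes nonneg: "\<And>t. cnonneg (a t)" "\<And>t. cnonneg (b t)"
    and parity: "\<And>s t. s < t \<Longrightarrow> if even s then b t * a s \<preceq> a t * b s else a t * b s \<preceq> b t * a s"
begin

lemma cnonneg_seg: "cnonneg (seg s d)" "cnonneg (lo_out s d)"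
  by (induction s d and s d rule: seg_lo_out.induct) (auto simp: nonneg)

lemma cnonneg_hi: "cnonneg (hi_out s d)"
  by (cases d) (auto simp: nonneg cnonneg_seg)

text \<open>The sides weigh the subsets of the path \<open>s, ..., s + d + 1\<close> that contain
  only the top end or only the bottom end. The ends themselves are compared by
  \<open>parity\<close>. The inner path loses the neighbour of the chosen end, so the favoured end
  switches there, and so does the parity in the induction hypothesis at \<open>s + 1\<close>; the
  two reversals cancel.\<close>

lemma flip_ends:
  "if even s then b (s + Suc d) * a s * hi_out (Suc s) d \<preceq> a (s + Suc d) * b s * lo_out (Suc s) d
   else a (s + Suc d) * b s * lo_out (Suc s) d \<preceq> b (s + Suc d) * a s * hi_out (Suc s) d"
proof (induction d arbitrary: s rule: induct_nat_012)
  case 0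
  then show ?case using parity[of s "Suc s"] by simp
next
  case 1
  then show ?case using parity[of s "Suc (Suc s)"] nonneg
    by (auto intro!: cle_mult split: if_splits)
next
  case (ge2 d)
  \<comment> \<open>\<open>?z\<close> has both ends of the inner path unchosen, \<open>?f\<close>
    only its top end chosen, \<open>?g\<close> only its bottom end chosen.\<close>
  let ?z = "a (Suc s) * seg (Suc (Suc s)) d * a (Suc s + Suc d)"
  let ?f = "b (Suc s + Suc d) * a (Suc s) * hi_out (Suc (Suc s)) d"
  let ?g = "a (Suc s + Suc d) * b (Suc s) * lo_out (Suc (Suc s)) d"
  have t: "hi_out (Suc s) (Suc (Suc d)) = ?z + ?g"
    by (simp only: hi_out.simps seg.simps) (simp only: algebra_simps)
  have b: "lo_out (Suc s) (Suc (Suc d)) = ?z + ?f"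
    by (simp only: lo_out.simps seg_Suc_hi add_Suc_right add_Suc) (simp only: algebra_simps)
  have "if even s then ?g \<preceq> ?f else ?f \<preceq> ?g"
    using ge2.IH(1)[of "Suc s"] by (cases "even s") simp_all
  then have "if even s then ?z + ?g \<preceq> ?z + ?f else ?z + ?f \<preceq> ?z + ?g"
    by (auto intro: cle_add split: if_splits)
  moreover have "cnonneg (?z + ?f)" "cnonneg (?z + ?g)"
    by (auto simp: nonneg cnonneg_seg cnonneg_hi)
  ultimately show ?case
    using parity[of s "s + Suc (Suc (Suc d))"] nonneg unfolding t b
    by (auto intro!: cle_mult split: if_splits simp del: hi_out.simps)
qed

text \<open>Subsets that contain both ends of the path \<open>0, ..., d + 1\<close> contribute
  equally to both sides; the others are compared by \<open>flip_ends\<close> at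
  \<open>s = 0\<close>.\<close>

lemma hi_end_cle_lo_end: "b (Suc d) * hi_out 0 (Suc d) \<preceq> b 0 * lo_out 1 (Suc d)"
proof (cases d)
  case 0
  then show ?thesis using parity[of 0 1] by (simp add: mult.commute)
next
  case (Suc e)
  have "b (Suc d) * hi_out 0 (Suc d)
      = b (0 + Suc d) * a 0 * hi_out (Suc 0) d + b (Suc d) * b 0 * (lo_out 1 e * a (1 + e))"
    unfolding Suc by (simp add: algebra_simps)
  also have "\<dots> \<preceq> a (0 + Suc d) * b 0 * lo_out (Suc 0) d + b (Suc d) * b 0 * (lo_out 1 e * a (1 + e))"
    using flip_ends[of 0 d] by (intro cle_add) (auto simp del: hi_out.simps)
  also have "\<dots> = b 0 * lo_out 1 (Suc d)"
    unfolding Suc lo_hi_out by (simp only: lo_out_Suc_hi One_nat_def add_Suc add_0) (simp only: algebra_simps)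
  finally show ?thesis .
qed

end

end

section \<open>Perfect trees as weighted paths from a leaf to the root\<close>

lemma tree_poly_eq_seg:
  assumes "0 < r"
  shows "seg (out_wt r) (in_wt r) 0 d = tree_poly r d"
proof (induction d rule: induct_nat_012)
  case 0
  then show ?case by simp
next
  case 1
  then show ?case by (simp add: out_wt_def)
next
  case (ge2 d)
  then show ?case
    by (simp only: seg_Suc_hi[of _ _ _ "Suc d"] tree_poly_rec[OF assms] hi_out.simps add_0 mult_ac)
qed

text \<open>The leaf is vertex 0 of the path and has weight \<open>X\<close>; choosing it forces
  vertex 1 out and leaves the path \<open>1, ..., d\<close>.\<close>

lemma star_poly_eq_lo_out:
  assumes "0 < r"
  shows "star_poly r 1 (Suc d) = X * lo_out (out_wt r) (in_wt r) 1 d"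
proof (induction d rule: induct_nat_012)
  case 0
  then show ?case by simp
next
  case 1
  then show ?case by (simp add: out_wt_def)
next
  case (ge2 d)
  \<comment> \<open>Brings the summand of \<open>lo_out_Suc_hi\<close> with chosen top vertex into
    the shape of \<open>star_poly_rec\<close>.\<close>
  have "in_wt r (Suc (Suc d)) * out_wt r 1 * hi_out (out_wt r) (in_wt r) 2 d
      = in_wt r (Suc (Suc d)) * (lo_out (out_wt r) (in_wt r) 1 d * out_wt r (Suc d))"
    using lo_hi_out[of "out_wt r" "in_wt r" 1 d] by (simp add: numeral_2_eq_2 mult.assoc)
  then show ?case
    using ge2 assms
    by (simp only: star_poly_rec lo_out_Suc_hi numeral_2_eq_2 One_nat_def add_Suc add_0 le_add1 Suc_le_mono le0)
      (simp only: algebra_simps)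
qed

text \<open>The left side is \<open>star_poly r (Suc g) (Suc g)\<close>, the star of the root. On
  the path from the leaf at index 0 to the root at index \<open>g\<close> the claim becomes
  \<open>hi_end_cle_lo_end\<close>.\<close>

lemma root_cle_leaf:
  assumes "0 < r"
  shows "X * tree_poly r (g - 1) ^ r\<^sup>2 \<preceq> star_poly r 1 (Suc g)"
proof (cases g)
  case 0
  then show ?thesis by simp
next
  case (Suc d)
  have "tree_poly r d ^ (r\<^sup>2 - 1) * tree_poly r d = tree_poly r d ^ r\<^sup>2"
    using assms by (simp flip: power_Suc2)
  then have "X * tree_poly r d ^ r\<^sup>2 = in_wt r (Suc d) * out_wt r d * tree_poly r d"
    by (simp only: in_out_wt[OF assms] mult.assoc)
  also have "\<dots> = in_wt r (Suc d) * (tree_poly r d * out_wt r d)"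
    by (simp only: mult_ac)
  also have "\<dots> \<preceq> in_wt r 0 * lo_out (out_wt r) (in_wt r) 1 (Suc d)"
    using hi_end_cle_lo_end[of "out_wt r" "in_wt r" d] wt_parity assms
    by (simp add: tree_poly_eq_seg del: lo_out.simps)
  also have "\<dots> = star_poly r 1 (Suc g)"
    by (simp only: Suc star_poly_eq_lo_out[OF assms] in_wt_0)
  finally show ?thesis using Suc by simp
qed

text \<open>Above height \<open>g\<close> both sides obey the same recursion. This leaves
  \<open>h = g\<close>, where the vertex is the root of its tree, and \<open>h < g\<close>, where
  the left side is 0.\<close>

lemma star_cle_leaf:
  assumes "0 < r" "1 \<le> g"
  shows "star_poly r g h \<preceq> star_poly r 1 h"
proof (induction h rule: less_induct)
  case (less h)
  consider "h < g" | "h = g" | t where "h = Suc (Suc t)" "g \<le> Suc t"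
    using assms by (metis One_nat_def Suc_le_D le_Suc_eq not_less_eq_eq not_le)
  then show ?case
  proof cases
    case 1
    then show ?thesis by (cases h) auto
  next
    case 2
    then obtain d where "g = Suc d" "h = Suc d" using assms by (cases g) auto
    then show ?thesis
      using root_cle_leaf[OF assms(1), of d] by (simp only: star_poly.simps(2)[of r g d]) simp
  next
    case 3
    then show ?thesis
      using less.IH[of t] less.IH[of "Suc t"] assms
      by (auto simp: star_poly_rec simp del: star_poly.simps(2) intro!: cle_add cle_mult_left)
  qed
qed

section \<open>Comparing leaves of two perfect trees\<close>

text \<open>The determinant of two solutions of one three-term recursion is multiplied by
  \<open>- ?c\<close> at each step, so its sign alternates.\<close>

lemma star_tree_adjacent:
  assumes "0 < r"
  shows "if even h
         then star_poly r 1 h * tree_poly r (Suc h) \<preceq> star_poly r 1 (Suc h) * tree_poly r h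
         else star_poly r 1 (Suc h) * tree_poly r h \<preceq> star_poly r 1 h * tree_poly r (Suc h)"
proof (induction h)
  case 0
  then show ?case by simp
next
  case (Suc h)
  let ?p = "tree_poly r" and ?s = "star_poly r 1" and ?c = "in_wt r (Suc h) * out_wt r h"
  have "?s (Suc (Suc h)) * ?p (Suc h) - ?s (Suc h) * ?p (Suc (Suc h))
      = ?c * (?s h * ?p (Suc h) - ?s (Suc h) * ?p h)"
    using assms by (simp only: tree_poly_rec star_poly_rec le_add1 Suc_le_mono le0 One_nat_def)
      (simp only: algebra_simps)
  moreover from this have "?s (Suc h) * ?p (Suc (Suc h)) - ?s (Suc (Suc h)) * ?p (Suc h)
      = ?c * (?s (Suc h) * ?p h - ?s h * ?p (Suc h))"
    by (metis minus_diff_eq mult_minus_right)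
  ultimately show ?case
    using Suc.IH unfolding cle_def by (cases "even h") (simp_all del: tree_poly.simps star_poly.simps)
qed

text \<open>For fixed \<open>h\<close> both products obey the recursion in \<open>h'\<close>. It
  starts from equality at \<open>h' = h\<close> and from \<open>star_tree_adjacent\<close> at
  \<open>h' = h + 1\<close>.\<close>

lemma star_tree_same_arity:
  assumes "0 < r" "h < h'"
  shows "if even h
         then star_poly r 1 h * tree_poly r h' \<preceq> star_poly r 1 h' * tree_poly r h
         else star_poly r 1 h' * tree_poly r h \<preceq> star_poly r 1 h * tree_poly r h'"
  using assms(2)
proof (induction h' rule: less_induct)
  case (less h')
  let ?p = "tree_poly r" and ?s = "star_poly r 1"
  show ?case
  proof (cases "h' = Suc h")
    case True
    then show ?thesis using star_tree_adjacent[OF assms(1), of h] by (simp only: True)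
  next
    case False
    then have "h' = Suc (Suc (h' - 2))" "h < Suc (h' - 2)"
      using less.prems by auto
    then obtain t where t: "h' = Suc (Suc t)" "h < Suc t" by blast
    have 1: "?s h * ?p h' = out_wt r (Suc t) * (?s h * ?p (Suc t)) + in_wt r (Suc t) * out_wt r t * (?s h * ?p t)"
      using assms t by (simp only: tree_poly_rec) (simp only: algebra_simps)
    have 2: "?s h' * ?p h = out_wt r (Suc t) * (?s (Suc t) * ?p h) + in_wt r (Suc t) * out_wt r t * (?s t * ?p h)"
      using assms t by (simp only: star_poly_rec le_add1 Suc_le_mono le0 One_nat_def) (simp only: algebra_simps)
    have "if even h then ?s h * ?p t \<preceq> ?s t * ?p h else ?s t * ?p h \<preceq> ?s h * ?p t"
      using less.IH[of t] t by (cases "h = t") (auto simp del: tree_poly.simps star_poly.simps)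
    moreover have "if even h then ?s h * ?p (Suc t) \<preceq> ?s (Suc t) * ?p h else ?s (Suc t) * ?p h \<preceq> ?s h * ?p (Suc t)"
      using less.IH[of "Suc t"] t by (simp del: tree_poly.simps star_poly.simps)
    ultimately show ?thesis
      unfolding 1 2
      by (cases "even h") (auto simp del: tree_poly.simps star_poly.simps intro!: cle_add cle_mult_left)
  qed
qed

section \<open>Trees of different arity\<close>

lemma star_tree_less_arity_base:
  assumes "0 < s" "s < r" "h = 2 \<or> h = 3"
  shows "star_poly s 1 h * tree_poly r 2 \<preceq> star_poly r 1 2 * tree_poly s h"
proof -
  \<comment> \<open>\<open>u\<close> collects powers of \<open>y\<close> common to both arities and
    \<open>w\<close> the surplus of the larger one; \<open>A\<close> and \<open>b\<close> are the
    powers with exponent \<open>s - 1\<close> of \<open>tree_poly s 2\<close> and of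
    \<open>tree_poly s 1 ^ s\<close>.\<close>
  define y u w A b where "y = 1 + X" and "u = y ^ (s - 1)" and "w = y ^ (r - s)"
    and "A = (y * u + X) ^ (s - 1)" and "b = (y * u) ^ (s - 1)"
  have y1: "1 \<preceq> y" by (simp add: y_def cle_def)
  then have nonneg: "cnonneg y" "cnonneg u" "cnonneg b"
    by (auto simp: u_def b_def y_def)
  have ys: "y ^ s = y * u" and yr1: "y ^ (r - 1) = u * w" and yr: "y ^ r = y * u * w"
    using assms by (simp_all add: u_def w_def flip: power_Suc power_add)
  have "s\<^sup>2 = s + s * (s - 1)" "s\<^sup>2 - 1 = s - 1 + s * (s - 1)"
    using assms(1) by (cases s; simp add: power2_eq_square)+
  then have yss: "y ^ s\<^sup>2 = y * u * b" and yss1: "y ^ (s\<^sup>2 - 1) = u * b"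
    by (simp_all add: power_add power_mult ys b_def) (simp_all add: u_def)
  have As: "(y * u + X) ^ s = (y * u + X) * A"
    using assms by (simp add: A_def flip: power_Suc)
  have p2: "tree_poly r 2 = y * u * w + X" "tree_poly s 2 = y * u + X"
    using yr ys by (simp_all add: numeral_2_eq_2 y_def)
  have s2: "star_poly r 1 2 = X * u * w" "star_poly s 1 2 = X * u"
    using yr1 u_def by (simp_all add: numeral_2_eq_2 y_def mult_ac)
  have p3: "tree_poly s 3 = (y * u + X) * A + X * (y * u * b)"
    using yss As ys by (simp add: numeral_3_eq_3 numeral_2_eq_2 y_def)
  have s3: "star_poly s 1 3 = A * (X * u) + X * (u * b) * X"
    using yss1 u_def ys A_def by (simp add: numeral_3_eq_3 numeral_2_eq_2 y_def mult_ac)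
  \<comment> \<open>Here \<open>s < r\<close> enters: at least one factor \<open>y\<close> is left
    over.\<close>
  have yw: "y \<preceq> w"
  proof -
    have "w = y * y ^ (r - s - 1)"
      using assms by (simp add: w_def Suc_diff_Suc flip: power_Suc)
    then show ?thesis
      using cle_mult[of y y 1 "y ^ (r - s - 1)"] y1 nonneg by (simp add: one_cle_power)
  qed
  from assms(3) show ?thesis
  proof
    assume "h = 2"
    have "X * u * w * (y * u + X) - X * u * (y * u * w + X) = X * u * X * (w - 1)"
      by (simp only: algebra_simps)
    moreover have "cnonneg (w - 1)"
      using cle_trans[OF y1 yw] by (simp add: cle_def)
    ultimately show ?thesis
      unfolding \<open>h = 2\<close> p2 s2 cle_def using nonneg by simp
  next
    assume "h = 3"
    have "b \<preceq> A"
      unfolding b_def A_def using nonneg by (intro cle_power) (auto simp: cle_def)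
    \<comment> \<open>Uses \<open>yw\<close> in the form \<open>X \<preceq> w - 1\<close>.\<close>
    then have "X * b \<preceq> (w - 1) * A"
      using yw nonneg by (intro cle_mult) (auto simp: y_def cle_def algebra_simps dest: cnonneg_cle)
    then have "cnonneg (X * X * u * ((w - 1) * A - X * b))"
      using nonneg by (simp add: cle_def)
    moreover have "X * X * u * ((w - 1) * A - X * b)
        = X * u * w * ((y * u + X) * A + X * (y * u * b)) - (A * (X * u) + X * (u * b) * X) * (y * u * w + X)"
      by (simp only: algebra_simps)
    ultimately show ?thesis
      unfolding \<open>h = 3\<close> p2 s2 p3 s3 cle_def by simp
  qed
qed

text \<open>The recursion in \<open>h\<close> for arity \<open>s\<close> needs two consecutive
  starting heights, here 2 and 3.\<close>

lemma star_tree_less_arity_2: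
  assumes "0 < s" "s < r" "2 \<le> h"
  shows "star_poly s 1 h * tree_poly r 2 \<preceq> star_poly r 1 2 * tree_poly s h"
  using assms(3)
proof (induction h rule: less_induct)
  case (less h)
  show ?case
  proof (cases "h = 2 \<or> h = 3")
    case True
    then show ?thesis using assms star_tree_less_arity_base by blast
  next
    case False
    then have "h = Suc (Suc (h - 2))" "2 \<le> h - 2"
      using less.prems by auto
    then obtain t where t: "h = Suc (Suc t)" "2 \<le> t" by blast
    have 1: "star_poly r 1 2 * tree_poly s h = out_wt s (Suc t) * (star_poly r 1 2 * tree_poly s (Suc t))
        + in_wt s (Suc t) * out_wt s t * (star_poly r 1 2 * tree_poly s t)"
      using assms t by (simp only: tree_poly_rec) (simp only: algebra_simps)
    have 2: "star_poly s 1 h * tree_poly r 2 = out_wt s (Suc t) * (star_poly s 1 (Suc t) * tree_poly r 2)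
        + in_wt s (Suc t) * out_wt s t * (star_poly s 1 t * tree_poly r 2)"
      using assms t by (simp only: star_poly_rec le_add1 Suc_le_mono le0 One_nat_def) (simp only: algebra_simps)
    show ?thesis
      unfolding 1 2 using less.IH t by (intro cle_add cle_mult_left) (auto simp del: tree_poly.simps star_poly.simps)
  qed
qed

text \<open>The recursion for arity \<open>r\<close> reduces \<open>h\<close> to 1 and 2. A single
  vertex is the same tree in every arity, so \<open>h = 1\<close> is the optimality of height 1
  within arity \<open>s\<close>. For the same reason \<open>h'\<close> must be at least 2: a single
  vertex would win against taller trees of arity \<open>r\<close>.\<close>

lemma star_tree_less_arity:
  assumes "0 < s" "s < r" "2 \<le> h'" "1 \<le> h"
  shows "star_poly s 1 h' * tree_poly r h \<preceq> star_poly r 1 h * tree_poly s h'"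
  using assms(4)
proof (induction h rule: less_induct)
  case (less h)
  consider "h = 1" | "h = 2" | t where "h = Suc (Suc t)" "1 \<le> t"
    using less.prems by (metis One_nat_def Suc_1 Suc_le_D le_antisym not_less_eq_eq)
  then show ?case
  proof cases
    case 1
    have "star_poly s 1 h' * tree_poly s 1 \<preceq> star_poly s 1 1 * tree_poly s h'"
      using star_tree_same_arity[OF assms(1), of 1 h'] assms(3) by simp
    then show ?thesis using 1 by simp
  next
    case 2
    then show ?thesis using assms star_tree_less_arity_2 by blast
  next
    case (3 t)
    have 1: "star_poly r 1 h * tree_poly s h' = out_wt r (Suc t) * (star_poly r 1 (Suc t) * tree_poly s h')
        + in_wt r (Suc t) * out_wt r t * (star_poly r 1 t * tree_poly s h')"
      using assms 3 by (simp only: star_poly_rec le_add1 Suc_le_mono le0 One_nat_def) (simp only: algebra_simps)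
    have 2: "star_poly s 1 h' * tree_poly r h = out_wt r (Suc t) * (star_poly s 1 h' * tree_poly r (Suc t))
        + in_wt r (Suc t) * out_wt r t * (star_poly s 1 h' * tree_poly r t)"
      using assms 3 by (simp only: tree_poly_rec) (simp only: algebra_simps)
    show ?thesis
      unfolding 1 2 using less.IH 3 by (intro cle_add cle_mult_left) (auto simp del: tree_poly.simps star_poly.simps)
  qed
qed

section \<open>Independence polynomials\<close>

text \<open>The vertex set is a parameter of its own, so that deleting vertices leaves the adjacency
  untouched; the prescribed part \<open>C\<close> treats stars and the family of all independent
  sets alike.\<close>

definition indep_fam :: "('a \<Rightarrow> 'a \<Rightarrow> bool) \<Rightarrow> 'a set \<Rightarrow> 'a set \<Rightarrow> 'a set set" where
  "indep_fam E U C = {A. C \<subseteq> A \<and> A \<subseteq> U \<and> pairwise (\<lambda>u w. \<not> E u w) A}"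

definition indep_poly :: "('a \<Rightarrow> 'a \<Rightarrow> bool) \<Rightarrow> 'a set \<Rightarrow> 'a set \<Rightarrow> int poly" where
  "indep_poly E U C = (\<Sum>A\<in>indep_fam E U C. monom 1 (card A))"

lemma finite_indep_fam: "finite U \<Longrightarrow> finite (indep_fam E U C)"
  by (rule finite_subset[of _ "Pow U"]) (auto simp: indep_fam_def)

lemma cnonneg_indep_poly [simp]: "cnonneg (indep_poly E U C)"
  by (simp add: indep_poly_def cnonneg_sum)

lemma coeff_indep_poly:
  assumes "finite U"
  shows "coeff (indep_poly E U C) k = int (card {A \<in> indep_fam E U C. card A = k})"
  using finite_indep_fam[OF assms]
  by (simp add: indep_poly_def coeff_sum sum.If_cases Int_def)

lemma indep_poly_empty [simp]: "indep_poly E {} {} = 1"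
proof -
  have "indep_fam E {} {} = {{}}" by (auto simp: indep_fam_def)
  then show ?thesis by (simp add: indep_poly_def)
qed

lemma indep_poly_not_subset: "\<not> C \<subseteq> U \<Longrightarrow> indep_poly E U C = 0"
proof -
  assume "\<not> C \<subseteq> U"
  then have "indep_fam E U C = {}" by (auto simp: indep_fam_def)
  then show ?thesis by (simp add: indep_poly_def)
qed

lemma indep_poly_split:
  assumes "finite U" "a \<notin> C"
  shows "indep_poly E U C = indep_poly E (U - {a}) C + indep_poly E U (insert a C)"
proof -
  have "indep_fam E U C = indep_fam E (U - {a}) C \<union> indep_fam E U (insert a C)"
    using assms(2) by (auto simp: indep_fam_def)
  moreover have "indep_fam E (U - {a}) C \<inter> indep_fam E U (insert a C) = {}"
    by (auto simp: indep_fam_def)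
  ultimately show ?thesis
    using assms by (simp add: indep_poly_def sum.union_disjoint finite_indep_fam)
qed

text \<open>Choosing \<open>a\<close> deletes its closed neighbourhood. If \<open>C\<close> contains
  a neighbour of \<open>a\<close>, both sides vanish; this occurs when the marked vertex is a child
  of the chosen root.\<close>

lemma indep_poly_insert:
  assumes "finite U" "a \<in> U" "a \<notin> C" and sym: "\<And>u w. E u w \<Longrightarrow> E w u"
  shows "indep_poly E U (insert a C) = X * indep_poly E (U - insert a {w. E a w}) C"
proof -
  let ?N = "insert a {w. E a w}"
  have "indep_fam E U (insert a C) = insert a ` indep_fam E (U - ?N) C"
  proof
    show "indep_fam E U (insert a C) \<subseteq> insert a ` indep_fam E (U - ?N) C"
    proof
      fix A assume "A \<in> indep_fam E U (insert a C)"
      then have "A = insert a (A - {a})" "A - {a} \<in> indep_fam E (U - ?N) C"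
        using assms(3) by (auto simp: indep_fam_def pairwise_def)
      then show "A \<in> insert a ` indep_fam E (U - ?N) C" by blast
    qed
    show "insert a ` indep_fam E (U - ?N) C \<subseteq> indep_fam E U (insert a C)"
      using assms(2) by (auto simp: indep_fam_def pairwise_insert) (use sym in blast)+
  qed
  moreover have "inj_on (insert a) (indep_fam E (U - ?N) C)"
    by (auto simp: inj_on_def indep_fam_def)
  moreover have "card (insert a A) = Suc (card A)" if "A \<in> indep_fam E (U - ?N) C" for A
  proof -
    have "A \<subseteq> U" "a \<notin> A" using that by (auto simp: indep_fam_def)
    then show ?thesis using assms(1) finite_subset by fastforce
  qed
  moreover have "X * monom 1 n = monom 1 (Suc n)" for n
    by (simp add: X_def monom_Suc)
  ultimately show ?thesis
    by (simp add: indep_poly_def sum.reindex sum_distrib_left)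
qed

lemma indep_poly_Un:
  assumes "finite U" "finite W" "U \<inter> W = {}" "C \<subseteq> U"
    and "\<And>u w. u \<in> U \<Longrightarrow> w \<in> W \<Longrightarrow> \<not> E u w \<and> \<not> E w u"
  shows "indep_poly E (U \<union> W) C = indep_poly E U C * indep_poly E W {}"
proof -
  let ?I = "indep_fam E U C \<times> indep_fam E W {}"
  have "bij_betw (\<lambda>(A, B). A \<union> B) ?I (indep_fam E (U \<union> W) C)"
  proof (rule bij_betw_byWitness[where f' = "\<lambda>A. (A \<inter> U, A \<inter> W)"])
    show "\<forall>p\<in>?I. (\<lambda>A. (A \<inter> U, A \<inter> W)) ((\<lambda>(A, B). A \<union> B) p) = p"
      using assms(3) by (auto simp: indep_fam_def)
    show "\<forall>A\<in>indep_fam E (U \<union> W) C. (\<lambda>(A, B). A \<union> B) (A \<inter> U, A \<inter> W) = A"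
      by (auto simp: indep_fam_def)
    show "(\<lambda>(A, B). A \<union> B) ` ?I \<subseteq> indep_fam E (U \<union> W) C"
      using assms(5) unfolding indep_fam_def pairwise_def by clarsimp blast
    show "(\<lambda>A. (A \<inter> U, A \<inter> W)) ` indep_fam E (U \<union> W) C \<subseteq> ?I"
      using assms(4) by (auto simp: indep_fam_def pairwise_def)
  qed
  then have "indep_poly E (U \<union> W) C = (\<Sum>(A, B)\<in>?I. monom 1 (card (A \<union> B)))"
    by (simp add: indep_poly_def case_prod_unfold flip: sum.reindex_bij_betw)
  also have "\<dots> = (\<Sum>(A, B)\<in>?I. monom 1 (card A) * monom 1 (card B))"
  proof (rule sum.cong[OF refl], clarify)
    fix A B assume "A \<in> indep_fam E U C" "B \<in> indep_fam E W {}"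
    then have "A \<subseteq> U" "B \<subseteq> W" by (auto simp: indep_fam_def)
    then have "card (A \<union> B) = card A + card B"
      using assms(1-3) by (intro card_Un_disjoint) (auto intro: finite_subset)
    then show "monom (1::int) (card (A \<union> B)) = monom 1 (card A) * monom 1 (card B)"
      by (simp add: mult_monom)
  qed
  also have "\<dots> = indep_poly E U C * indep_poly E W {}"
    by (simp add: indep_poly_def sum_product sum.cartesian_product)
  finally show ?thesis .
qed

lemma indep_poly_UN:
  assumes "finite I" "\<And>i. i \<in> I \<Longrightarrow> finite (U i)" "disjoint_family_on U I"
    and "\<And>i j u w. i \<in> I \<Longrightarrow> j \<in> I \<Longrightarrow> i \<noteq> j \<Longrightarrow> u \<in> U i \<Longrightarrow> w \<in> U j \<Longrightarrow> \<not> E u w"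
  shows "indep_poly E (\<Union>i\<in>I. U i) {} = (\<Prod>i\<in>I. indep_poly E (U i) {})"
  using assms
proof (induction I rule: finite_induct)
  case empty
  then show ?case by simp
next
  case (insert i I)
  have "indep_poly E (U i \<union> (\<Union>i\<in>I. U i)) {} = indep_poly E (U i) {} * indep_poly E (\<Union>i\<in>I. U i) {}"
  proof (rule indep_poly_Un)
    show "finite (U i)" "finite (\<Union>i\<in>I. U i)"
      using insert by auto
    show "U i \<inter> (\<Union>i\<in>I. U i) = {}"
      using insert by (auto simp: disjoint_family_on_def)
    show "\<not> E u w \<and> \<not> E w u" if "u \<in> U i" "w \<in> (\<Union>i\<in>I. U i)" for u w
      using that insert.hyps(2) insert.prems(3) by blast
  qed simp
  moreover have "indep_poly E (\<Union>i\<in>I. U i) {} = (\<Prod>i\<in>I. indep_poly E (U i) {})"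
    using insert.prems by (intro insert.IH) (auto simp: disjoint_family_on_def, blast)
  ultimately show ?case
    using insert.hyps by simp
qed

lemma indep_poly_UN_star:
  assumes "finite I" "\<And>i. i \<in> I \<Longrightarrow> finite (U i)" "disjoint_family_on U I"
    and "\<And>i j u w. i \<in> I \<Longrightarrow> j \<in> I \<Longrightarrow> i \<noteq> j \<Longrightarrow> u \<in> U i \<Longrightarrow> w \<in> U j \<Longrightarrow> \<not> E u w"
    and "i \<in> I" "v \<in> U i"
  shows "indep_poly E (\<Union>i\<in>I. U i) {v} = indep_poly E (U i) {v} * (\<Prod>j\<in>I - {i}. indep_poly E (U j) {})"
proof -
  have "(\<Union>i\<in>I. U i) = U i \<union> (\<Union>j\<in>I - {i}. U j)"
    using assms(5) by auto
  also have "indep_poly E \<dots> {v} = indep_poly E (U i) {v} * indep_poly E (\<Union>j\<in>I - {i}. U j) {}"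
  proof (rule indep_poly_Un)
    show "U i \<inter> (\<Union>j\<in>I - {i}. U j) = {}"
      using assms(3,5) by (auto simp: disjoint_family_on_def)
    show "\<not> E u w \<and> \<not> E w u" if "u \<in> U i" "w \<in> (\<Union>j\<in>I - {i}. U j)" for u w
      using that assms(4,5) by blast
  qed (use assms in auto)
  also have "indep_poly E (\<Union>j\<in>I - {i}. U j) {} = (\<Prod>j\<in>I - {i}. indep_poly E (U j) {})"
    using assms by (intro indep_poly_UN) (auto simp: disjoint_family_on_def)
  finally show ?thesis .
qed

section \<open>Perfect rooted trees\<close>

text \<open>In the application \<open>lev\<close> counts levels from the leaves upwards. Its drop by
  one along each child edge takes the place of acyclicity. Apart from symmetry, \<open>E\<close> is
  constrained on \<open>V\<close> only, so it can be the adjacency of a whole forest.\<close>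

locale perfect_rooted_tree =
  fixes E :: "'a \<Rightarrow> 'a \<Rightarrow> bool" and V :: "'a set" and ch :: "'a \<Rightarrow> 'a set"
    and lev :: "'a \<Rightarrow> nat" and r :: nat
  assumes finite_V: "finite V"
    and E_sym: "E u w \<Longrightarrow> E w u"
    and E_iff: "u \<in> V \<Longrightarrow> w \<in> V \<Longrightarrow> E u w \<longleftrightarrow> w \<in> ch u \<or> u \<in> ch w"
    and ch_V: "u \<in> V \<Longrightarrow> w \<in> ch u \<Longrightarrow> w \<in> V"
    and lev_ch: "u \<in> V \<Longrightarrow> w \<in> ch u \<Longrightarrow> lev u = Suc (lev w)"
    and parent_unique: "u \<in> V \<Longrightarrow> u' \<in> V \<Longrightarrow> w \<in> ch u \<Longrightarrow> w \<in> ch u' \<Longrightarrow> u = u'"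
    and lev_pos: "u \<in> V \<Longrightarrow> 0 < lev u"
    and card_ch: "u \<in> V \<Longrightarrow> 1 < lev u \<Longrightarrow> card (ch u) = r"
begin

definition child_rel :: "('a \<times> 'a) set" where
  "child_rel = {(u, w). u \<in> V \<and> w \<in> ch u}"

definition desc :: "'a \<Rightarrow> 'a set" where
  "desc u = {w. (u, w) \<in> child_rel\<^sup>*}"

lemma desc_self [simp]: "u \<in> desc u"
  by (simp add: desc_def)

lemma desc_ch: "w \<in> desc u \<Longrightarrow> w \<in> V \<Longrightarrow> x \<in> ch w \<Longrightarrow> x \<in> desc u"
  using rtrancl_into_rtrancl[of u w child_rel x] by (simp add: desc_def child_rel_def)

lemma desc_V_lev:
  assumes "u \<in> V" "w \<in> desc u"
  shows "w \<in> V \<and> lev w \<le> lev u \<and> (lev w = lev u \<longrightarrow> w = u)"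
proof -
  have "(u, w) \<in> child_rel\<^sup>*" using assms by (simp add: desc_def)
  then show ?thesis
  proof (induction rule: rtrancl_induct)
    case base
    then show ?case using assms by simp
  next
    case (step y z)
    then have "y \<in> V" "z \<in> ch y" by (auto simp: child_rel_def)
    then show ?case using step.IH lev_ch[of y z] ch_V by auto
  qed
qed

lemma desc_subset: "u \<in> V \<Longrightarrow> desc u \<subseteq> V"
  using desc_V_lev by blast

lemma finite_desc: "u \<in> V \<Longrightarrow> finite (desc u)"
  using desc_subset finite_V finite_subset by blast

lemma finite_ch: "u \<in> V \<Longrightarrow> finite (ch u)"
  by (meson ch_V finite_V finite_subset subsetI)

lemma desc_unfold:
  assumes "u \<in> V"
  shows "desc u = insert u (\<Union>c\<in>ch u. desc c)"
proof
  show "desc u \<subseteq> insert u (\<Union>c\<in>ch u. desc c)"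
    unfolding desc_def by (auto elim: converse_rtranclE simp: child_rel_def)
  show "insert u (\<Union>c\<in>ch u. desc c) \<subseteq> desc u"
    using assms converse_rtrancl_into_rtrancl[of u _ child_rel] by (auto simp: desc_def child_rel_def)
qed

text \<open>Parents are unique, so a common descendant can be pulled up along the path from
  \<open>c\<close>. Before it arrives at \<open>c\<close> its level is below that of
  \<open>c'\<close>, hence it stays a proper descendant of \<open>c'\<close>.\<close>

lemma desc_meet:
  assumes "c \<in> V" "c' \<in> V" "lev c = lev c'" "w \<in> desc c" "w \<in> desc c'"
  shows "c = c'"
proof -
  have "(c, w) \<in> child_rel\<^sup>*" using assms by (simp add: desc_def)
  then show ?thesis
    using assms(5)
  proof (induction rule: rtrancl_induct)
    case base
    then show ?case using assms desc_V_lev by metis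
  next
    case (step y z)
    then have y: "y \<in> V" "z \<in> ch y" by (auto simp: child_rel_def)
    have "lev y \<le> lev c" using step.hyps desc_V_lev assms(1) by (auto simp: desc_def)
    then have "z \<noteq> c'" using lev_ch[OF y] assms(3) by auto
    then obtain y' where "(c', y') \<in> child_rel\<^sup>*" "(y', z) \<in> child_rel"
      using step.prems unfolding desc_def by (auto elim: rtranclE)
    then show ?case
      using parent_unique[of y y' z] y step.IH by (auto simp: child_rel_def desc_def)
  qed
qed

lemma desc_no_edge:
  assumes "c \<in> V" "c' \<in> V" "lev c = lev c'" "c \<noteq> c'" "u \<in> desc c" "w \<in> desc c'"
  shows "\<not> E u w"
proof
  assume "E u w"
  moreover have "u \<in> V" "w \<in> V" using assms desc_subset by auto
  ultimately have "w \<in> desc c \<or> u \<in> desc c'"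
    using E_iff desc_ch assms(5,6) by blast
  then show False using desc_meet assms by metis
qed

context
  fixes Y t
  assumes Y: "Y \<subseteq> V" "\<And>c. c \<in> Y \<Longrightarrow> lev c = t"
begin

lemma finite_layer: "finite Y"
  using Y finite_V finite_subset by blast

lemma disjoint_layer: "disjoint_family_on desc Y"
proof -
  have "c = c'" if "c \<in> Y" "c' \<in> Y" "w \<in> desc c" "w \<in> desc c'" for c c' w
    using that desc_meet[of c c' w] Y by auto
  then show ?thesis unfolding disjoint_family_on_def by blast
qed

lemma layer_no_edge:
  "c \<in> Y \<Longrightarrow> c' \<in> Y \<Longrightarrow> c \<noteq> c' \<Longrightarrow> u \<in> desc c \<Longrightarrow> w \<in> desc c' \<Longrightarrow> \<not> E u w"
  using desc_no_edge[of c c' u w] Y by auto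

text \<open>Subtrees rooted at one level are disjoint and not joined by edges. The layers in
  question are the children and the grandchildren of a vertex.\<close>

lemma indep_poly_layer: "indep_poly E (\<Union>c\<in>Y. desc c) {} = (\<Prod>c\<in>Y. indep_poly E (desc c) {})"
  using Y(1) finite_desc
  by (intro indep_poly_UN finite_layer disjoint_layer) (auto dest: layer_no_edge)

lemma indep_poly_layer_star:
  "c \<in> Y \<Longrightarrow> v \<in> desc c \<Longrightarrow>
   indep_poly E (\<Union>c\<in>Y. desc c) {v} = indep_poly E (desc c) {v} * (\<Prod>c\<in>Y - {c}. indep_poly E (desc c) {})"
  using Y(1) finite_desc
  by (intro indep_poly_UN_star finite_layer disjoint_layer) (auto dest: layer_no_edge)

end

section \<open>Subtrees without their root and its neighbours\<close>

definition grandch :: "'a \<Rightarrow> 'a set" where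
  "grandch u = (\<Union>c\<in>ch u. ch c)"

lemma grandch_V: "u \<in> V \<Longrightarrow> grandch u \<subseteq> V"
  using ch_V unfolding grandch_def by blast

lemma lev_grandch:
  assumes "u \<in> V" "w \<in> grandch u"
  shows "lev u = Suc (Suc (lev w))"
proof -
  obtain c where "c \<in> ch u" "w \<in> ch c" using assms(2) by (auto simp: grandch_def)
  then show ?thesis using lev_ch[of u c] lev_ch[of c w] ch_V[of u c] assms(1) by simp
qed

lemma card_grandch:
  assumes "u \<in> V" "2 < lev u"
  shows "card (grandch u) = r\<^sup>2"
proof -
  have "lev c = lev u - 1" if "c \<in> ch u" for c
    using lev_ch[OF assms(1) that] by simp
  then have "card (ch c) = r" if "c \<in> ch u" for c
    using that assms card_ch[of c] ch_V[of u c] by simp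
  moreover have "card (grandch u) = (\<Sum>c\<in>ch u. card (ch c))"
    unfolding grandch_def using assms(1) ch_V finite_ch parent_unique
    by (intro card_UN_disjoint) blast+
  ultimately show ?thesis
    using assms card_ch by (simp add: power2_eq_square)
qed

lemma desc_minus:
  assumes "u \<in> V"
  shows "desc u - {u} = (\<Union>c\<in>ch u. desc c)"
proof -
  have "u \<notin> desc c" if "c \<in> ch u" for c
    using that assms desc_V_lev[of c u] lev_ch[of u c] ch_V[of u c] by auto
  then show ?thesis using desc_unfold[OF assms] by auto
qed

text \<open>The parent of \<open>u\<close> lies outside \<open>desc u\<close>, so the neighbours met
  there are the children; by level, no child lies below another one.\<close>

lemma desc_minus_nbrs:
  assumes "u \<in> V"
  shows "desc u - insert u {w. E u w} = (\<Union>c\<in>grandch u. desc c)"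
proof -
  have "w \<notin> desc u" if "u \<in> ch w" "w \<in> V" for w
    using that assms desc_V_lev[of u w] lev_ch[of w u] by auto
  then have "desc u - insert u {w. E u w} = (\<Union>c\<in>ch u. desc c) - ch u"
    using assms desc_minus[OF assms] desc_subset[OF assms] E_iff by blast
  also have "\<dots> = (\<Union>c\<in>ch u. desc c - {c})"
  proof -
    have "c' = c" if "c \<in> ch u" "c' \<in> ch u" "c' \<in> desc c" for c c'
      using that ch_V[OF assms, of c] lev_ch[OF assms, of c] lev_ch[OF assms, of c'] desc_V_lev[of c c'] by simp
    then show ?thesis by auto
  qed
  also have "\<dots> = (\<Union>c\<in>grandch u. desc c)"
    unfolding grandch_def using desc_minus ch_V[OF assms] by auto
  finally show ?thesis .
qed

lemma ch_leaf:
  assumes "u \<in> V" "lev u \<le> 1"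
  shows "ch u = {}"
proof -
  have False if "w \<in> ch u" for w
    using that assms lev_ch[of u w] lev_pos[of w] ch_V[of u w] by simp
  then show ?thesis by blast
qed

lemma grandch_low:
  assumes "u \<in> V" "lev u \<le> 2"
  shows "grandch u = {}"
proof -
  have False if "w \<in> grandch u" for w
    using that assms lev_grandch[of u w] lev_pos[of w] grandch_V[of u] by auto
  then show ?thesis by blast
qed

text \<open>The values at the grandchildren are a hypothesis, so that the lemma serves inside the
  induction for \<open>indep_poly_desc\<close> as well as after it.\<close>

lemma indep_poly_minus_nbrs:
  assumes "u \<in> V" "\<And>c. c \<in> grandch u \<Longrightarrow> indep_poly E (desc c) {} = tree_poly r (lev c)"
  shows "indep_poly E (desc u - insert u {w. E u w}) {} = tree_poly r (lev u - 2) ^ r\<^sup>2"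
proof -
  have "indep_poly E (\<Union>c\<in>grandch u. desc c) {} = (\<Prod>c\<in>grandch u. tree_poly r (lev u - 2))"
    using assms(2) grandch_V[OF assms(1)] lev_grandch[OF assms(1)]
    by (subst indep_poly_layer[of _ "lev u - 2"]) (auto intro!: prod.cong simp del: prod_constant)
  \<comment> \<open>For \<open>lev u \<le> 2\<close> there are no grandchildren, and truncated
    subtraction gives \<open>tree_poly r 0 = 1\<close>, the empty product.\<close>
  also have "\<dots> = tree_poly r (lev u - 2) ^ r\<^sup>2"
    using card_grandch[OF assms(1)] grandch_low[OF assms(1)] by (cases "lev u \<le> 2") auto
  finally show ?thesis
    by (simp add: desc_minus_nbrs[OF assms(1)])
qed

lemma indep_poly_desc:
  "u \<in> V \<Longrightarrow> indep_poly E (desc u) {} = tree_poly r (lev u)"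
proof (induction "lev u" arbitrary: u rule: less_induct)
  case less
  then have u: "u \<in> V" by simp
  obtain t where t: "lev u = Suc t" using lev_pos[OF u] by (cases "lev u") auto
  have "indep_poly E (\<Union>c\<in>ch u. desc c) {} = (\<Prod>c\<in>ch u. tree_poly r t)"
    using less.hyps ch_V[OF u] lev_ch[OF u] t
    by (subst indep_poly_layer[of _ t]) (auto intro!: prod.cong simp del: prod_constant)
  also have "\<dots> = tree_poly r t ^ r"
    using card_ch[OF u] ch_leaf[OF u] t by (cases t) auto
  finally have 1: "indep_poly E (desc u - {u}) {} = tree_poly r t ^ r"
    by (simp add: desc_minus[OF u])
  have 2: "indep_poly E (desc u - insert u {w. E u w}) {} = tree_poly r (t - 1) ^ r\<^sup>2"
    using less.hyps grandch_V[OF u] lev_grandch[OF u] t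
    by (subst indep_poly_minus_nbrs[OF u]) auto
  have "indep_poly E (desc u) {} = indep_poly E (desc u - {u}) {} + indep_poly E (desc u) {u}"
    using finite_desc[OF u] by (intro indep_poly_split) auto
  also have "indep_poly E (desc u) {u} = X * indep_poly E (desc u - insert u {w. E u w}) {}"
    using finite_desc[OF u] E_sym by (intro indep_poly_insert) auto
  finally show ?case
    by (simp add: 1 2 t)
qed

lemma indep_poly_desc_star:
  "u \<in> V \<Longrightarrow> v \<in> desc u \<Longrightarrow> indep_poly E (desc u) {v} = star_poly r (lev v) (lev u)"
proof (induction "lev u" arbitrary: u rule: less_induct)
  case less
  then have u: "u \<in> V" by simp
  obtain t where t: "lev u = Suc t" using lev_pos[OF u] by (cases "lev u") auto
  have ins: "indep_poly E (desc u) (insert u C) = X * indep_poly E (desc u - insert u {w. E u w}) C"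
    if "u \<notin> C" for C
    using that finite_desc[OF u] E_sym by (intro indep_poly_insert) auto
  show ?case
  proof (cases "v = u")
    case True
    then show ?thesis
      using ins[of "{}"] indep_poly_minus_nbrs[OF u] indep_poly_desc grandch_V[OF u] t by auto
  next
    case False
    then obtain c where c: "c \<in> ch u" "v \<in> desc c"
      using less.prems desc_unfold[OF u] by auto
    then have cV: "c \<in> V" "lev c = t" using ch_V[OF u] lev_ch[OF u] t by auto
    then have "1 < lev u" using lev_pos[of c] t by simp
    have vc: "lev v \<le> t" "lev v = t \<Longrightarrow> v = c"
      using desc_V_lev[OF cV(1) c(2)] cV by auto
    have "indep_poly E (desc u - {u}) {v}
        = indep_poly E (desc c) {v} * (\<Prod>c\<in>ch u - {c}. indep_poly E (desc c) {})"
      unfolding desc_minus[OF u]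
      using c ch_V[OF u] lev_ch[OF u] t by (intro indep_poly_layer_star[of _ t]) auto
    also have "(\<Prod>c\<in>ch u - {c}. indep_poly E (desc c) {}) = (\<Prod>c\<in>ch u - {c}. tree_poly r t)"
      using indep_poly_desc ch_V[OF u] lev_ch[OF u] t by (intro prod.cong) auto
    also have "\<dots> = tree_poly r t ^ (r - 1)"
      using card_ch[OF u \<open>1 < lev u\<close>] c(1) by simp
    also have "indep_poly E (desc c) {v} = star_poly r (lev v) t"
      using less.hyps[of c] cV c t by simp
    finally have 1: "indep_poly E (desc u - {u}) {v} = star_poly r (lev v) t * tree_poly r t ^ (r - 1)" .
    have 2: "indep_poly E (\<Union>c\<in>grandch u. desc c) {v}
        = tree_poly r (t - 1) ^ (r\<^sup>2 - 1) * star_poly r (lev v) (t - 1)"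
    proof (cases "v = c")
      case True
      \<comment> \<open>Here \<open>v\<close> is a child of \<open>u\<close> and is excluded when
        \<open>u\<close> is chosen, in accordance with the default value 0 of
        \<open>star_poly\<close>.\<close>
      have "v \<notin> (\<Union>c\<in>grandch u. desc c)"
        using True cV t lev_grandch[OF u] grandch_V[OF u] desc_V_lev by fastforce
      moreover have "star_poly r (lev v) (t - 1) = 0"
        using True cV lev_pos[of c] by (cases "t - 1") auto
      ultimately show ?thesis by (simp add: indep_poly_not_subset)
    next
      case False
      then obtain d where d: "d \<in> ch c" "v \<in> desc d"
        using c desc_unfold[OF cV(1)] by auto
      then have dg: "d \<in> grandch u" "d \<in> V" using c grandch_V[OF u] by (auto simp: grandch_def)
      then have dl: "lev d = t - 1" using lev_grandch[OF u] t by fastforce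
      have "1 < t" using lev_pos[of d] dg(2) lev_ch[OF cV(1) d(1)] cV by simp
      have "indep_poly E (\<Union>c\<in>grandch u. desc c) {v}
          = indep_poly E (desc d) {v} * (\<Prod>c\<in>grandch u - {d}. indep_poly E (desc c) {})"
        using dg d grandch_V[OF u] lev_grandch[OF u] t by (intro indep_poly_layer_star[of _ "t - 1"]) auto
      also have "(\<Prod>c\<in>grandch u - {d}. indep_poly E (desc c) {}) = (\<Prod>c\<in>grandch u - {d}. tree_poly r (t - 1))"
        using indep_poly_desc grandch_V[OF u] lev_grandch[OF u] t by (intro prod.cong) auto
      also have "\<dots> = tree_poly r (t - 1) ^ (r\<^sup>2 - 1)"
        using card_grandch[OF u] t \<open>1 < t\<close> dg(1) by simp
      also have "indep_poly E (desc d) {v} = star_poly r (lev v) (t - 1)"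
        using less.hyps[of d] dg dl d t by simp
      finally show ?thesis by (simp only: mult_ac)
    qed
    have "indep_poly E (desc u) {v} = indep_poly E (desc u - {u}) {v} + indep_poly E (desc u) (insert u {v})"
      using finite_desc[OF u] False by (intro indep_poly_split) auto
    also have "indep_poly E (desc u) (insert u {v}) = X * indep_poly E (desc u - insert u {w. E u w}) {v}"
      using False by (intro ins) simp
    also have "desc u - insert u {w. E u w} = (\<Union>c\<in>grandch u. desc c)"
      by (rule desc_minus_nbrs[OF u])
    finally show ?thesis
      unfolding 1 2 t using vc(1) by (simp add: mult_ac)
  qed
qed

end

section \<open>Distances in graph trees\<close>

lemma adj_sym: "adj G u v \<Longrightarrow> adj G v u"
  by (simp add: adj_def insert_commute)

lemma adj_verts: "simple_graph G \<Longrightarrow> adj G u v \<Longrightarrow> u \<in> verts G \<and> v \<in> verts G"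
  by (auto simp: simple_graph_def adj_def)

lemma adj_neq: "simple_graph G \<Longrightarrow> adj G u v \<Longrightarrow> u \<noteq> v"
  by (fastforce simp: simple_graph_def adj_def)

lemma walk_snoc: "p \<noteq> [] \<Longrightarrow> walk G (p @ [v]) \<longleftrightarrow> walk G p \<and> v \<in> verts G \<and> adj G (last p) v"
  by (auto simp: walk_def successively_append_iff)

lemma walk_Cons: "p \<noteq> [] \<Longrightarrow> walk G (v # p) \<longleftrightarrow> walk G p \<and> v \<in> verts G \<and> adj G v (hd p)"
  by (auto simp: walk_def successively_Cons)

locale rooted_graph_tree =
  fixes T :: "'a sgraph" and \<rho> :: 'a
  assumes tree: "graph_tree T" and root: "\<rho> \<in> verts T"
begin

abbreviation dist :: "'a \<Rightarrow> nat" where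
  "dist \<equiv> graph_dist T \<rho>"

lemma simple: "simple_graph T"
  using tree by (simp add: graph_tree_def graph_forest_def)

lemma geodesic:
  assumes "v \<in> verts T"
  obtains p where "walk T p" "hd p = \<rho>" "last p = v" "length p = Suc (dist v)"
proof -
  obtain p where p: "walk T p" "hd p = \<rho>" "last p = v"
    using tree root assms unfolding graph_tree_def graph_connected_def by blast
  then have "length p = Suc (length p - 1)"
    by (cases p) (auto simp: walk_def)
  then have "\<exists>d p. walk T p \<and> hd p = \<rho> \<and> last p = v \<and> length p = Suc d"
    using p by blast
  from LeastI_ex[OF this] show ?thesis
    using that unfolding graph_dist_def by blast
qed

lemma dist_le: "walk T p \<Longrightarrow> hd p = \<rho> \<Longrightarrow> last p = v \<Longrightarrow> length p = Suc d \<Longrightarrow> dist v \<le> d"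
  unfolding graph_dist_def by (rule Least_le) blast

lemma dist_root: "dist \<rho> = 0"
  using dist_le[of "[\<rho>]" \<rho> 0] root by (simp add: walk_def)

lemma dist_0: "v \<in> verts T \<Longrightarrow> dist v = 0 \<Longrightarrow> v = \<rho>"
  by (metis geodesic length_0_conv length_Suc_conv last.simps list.sel(1))

lemma dist_adj:
  assumes "adj T u v"
  shows "dist v \<le> Suc (dist u)"
proof -
  have uv: "u \<in> verts T" "v \<in> verts T" using adj_verts[OF simple assms] by auto
  obtain p where p: "walk T p" "hd p = \<rho>" "last p = u" "length p = Suc (dist u)"
    using geodesic[OF uv(1)] by blast
  then have "p \<noteq> []" by auto
  then show ?thesis
    using p uv assms by (intro dist_le[of "p @ [v]"]) (auto simp: walk_snoc)
qed

lemma parent_exists: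
  assumes "v \<in> verts T" "v \<noteq> \<rho>"
  obtains u where "u \<in> verts T" "adj T u v" "dist v = Suc (dist u)"
proof -
  obtain p where p: "walk T p" "hd p = \<rho>" "last p = v" "length p = Suc (dist v)"
    using geodesic[OF assms(1)] by blast
  then obtain q where q: "p = q @ [v]"
    by (metis append_butlast_last_id length_0_conv nat.distinct(1))
  with p assms have "q \<noteq> []" by auto
  with p q have w: "walk T q" "adj T (last q) v" "hd q = \<rho>" "length q = dist v"
    by (auto simp: walk_snoc)
  then have "length q = Suc (length q - 1)" using \<open>q \<noteq> []\<close> by (cases q) auto
  then have "dist (last q) \<le> length q - 1"
    using w by (intro dist_le) auto
  moreover have "dist v \<le> Suc (dist (last q))"
    using dist_adj w by blast
  ultimately have "dist v = Suc (dist (last q))"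
    using w \<open>q \<noteq> []\<close> by (cases q) auto
  then show ?thesis
    using that w adj_verts[OF simple] by blast
qed

text \<open>Otherwise both ends could be prolonged towards the root until they meet in a cycle.\<close>

lemma no_path_above:
  assumes "walk T (u # q @ [u'])" "distinct (u # q @ [u'])" "dist u = n" "dist u' = n"
    "\<forall>x\<in>set q. n < dist x"
  shows False
  using assms
proof (induction n arbitrary: u u' q)
  case 0
  then have "u \<in> verts T" "u' \<in> verts T" by (auto simp: walk_def)
  then have "u = u'" using dist_0 0 by metis
  then show ?case using 0 by simp
next
  case (Suc n)
  have V: "u \<in> verts T" "u' \<in> verts T" using Suc.prems by (auto simp: walk_def)
  have "u \<noteq> \<rho>" "u' \<noteq> \<rho>" using Suc.prems dist_root by auto
  obtain w where w: "w \<in> verts T" "adj T w u" "dist u = Suc (dist w)"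
    using parent_exists[OF V(1) \<open>u \<noteq> \<rho>\<close>] by blast
  obtain w' where w': "w' \<in> verts T" "adj T w' u'" "dist u' = Suc (dist w')"
    using parent_exists[OF V(2) \<open>u' \<noteq> \<rho>\<close>] by blast
  let ?p = "u # q @ [u']"
  have above: "\<forall>x\<in>set ?p. n < dist x" using Suc.prems by auto
  have n: "dist w = n" "dist w' = n" using w w' Suc.prems by auto
  have "w \<notin> set ?p" "w' \<notin> set ?p" using above n by auto
  have walk: "walk T (w # ?p)" using Suc.prems(1) w by (simp add: walk_Cons)
  show ?case
  proof (cases "w = w'")
    case True
    have "graph_cycle T (w # ?p)"
      using walk Suc.prems(2) \<open>w \<notin> set ?p\<close> w' True adj_sym by (auto simp: graph_cycle_def)
    then show ?thesis using tree by (auto simp: graph_tree_def graph_forest_def)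
  next
    case False
    have "walk T ((w # ?p) @ [w'])"
      using walk w' adj_sym by (subst walk_snoc) auto
    then have "walk T (w # ?p @ [w'])" by simp
    moreover have "distinct (w # ?p @ [w'])"
      using Suc.prems(2) \<open>w \<notin> set ?p\<close> \<open>w' \<notin> set ?p\<close> False by auto
    ultimately show ?thesis
      using Suc.IH n above by blast
  qed
qed

text \<open>\<open>no_path_above\<close> with empty interior; uniqueness of parents is the same with
  the interior \<open>[w]\<close>.\<close>

lemma adj_dist_neq:
  assumes "adj T u w"
  shows "dist u \<noteq> dist w"
proof
  assume "dist u = dist w"
  then show False
    using no_path_above[of u "[]" w "dist w"] assms adj_verts[OF simple assms] adj_neq[OF simple assms]
    by (auto simp: walk_def)
qed

lemma parent_unique:
  assumes "adj T u w" "adj T u' w" "dist w = Suc (dist u)" "dist w = Suc (dist u')"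
  shows "u = u'"
proof (rule ccontr)
  assume "u \<noteq> u'"
  moreover have "u \<noteq> w" "u' \<noteq> w" using assms by auto
  ultimately show False
    using no_path_above[of u "[w]" u' "dist u"] assms adj_verts[OF simple] adj_sym[OF assms(2)]
    by (auto simp: walk_def)
qed

lemma adj_iff_children:
  assumes "u \<in> verts T" "w \<in> verts T"
  shows "adj T u w \<longleftrightarrow> w \<in> children T \<rho> u \<or> u \<in> children T \<rho> w"
proof
  assume a: "adj T u w"
  then have "dist w = Suc (dist u) \<or> dist u = Suc (dist w)"
    using adj_dist_neq[OF a] dist_adj[OF a] dist_adj[OF adj_sym[OF a]] by linarith
  then show "w \<in> children T \<rho> u \<or> u \<in> children T \<rho> w"
    using a assms adj_sym by (auto simp: children_def)
qed (auto simp: children_def intro: adj_sym)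

lemma vertex_at_dist:
  "v \<in> verts T \<Longrightarrow> k \<le> dist v \<Longrightarrow> \<exists>u\<in>verts T. dist u = k"
proof (induction "dist v" arbitrary: v)
  case 0
  then show ?case by auto
next
  case (Suc n)
  show ?case
  proof (cases "k = dist v")
    case True
    then show ?thesis using Suc.prems by blast
  next
    case False
    have "v \<noteq> \<rho>" using Suc.hyps dist_root by auto
    then obtain u where "u \<in> verts T" "dist v = Suc (dist u)"
      using parent_exists Suc.prems by blast
    then show ?thesis using Suc False by auto
  qed
qed

end

section \<open>Perfect trees as instances of the abstract rooted trees\<close>

lemma perfect_tree_dist_less:
  assumes "perfect_tree T \<rho> r h" "v \<in> verts T"
  shows "graph_dist T \<rho> v < h"
proof (rule ccontr)
  interpret rooted_graph_tree T \<rho>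
    using assms(1) by unfold_locales (auto simp: perfect_tree_def)
  assume "\<not> graph_dist T \<rho> v < h"
  \<comment> \<open>A vertex too far away forces one at distance exactly \<open>h\<close>; its
    parent at distance \<open>h - 1\<close> is then a leaf with a child.\<close>
  then obtain w where w: "w \<in> verts T" "dist w = h"
    using vertex_at_dist[OF assms(2), of h] by auto
  have "1 \<le> h" using assms(1) by (simp add: perfect_tree_def)
  then have "w \<noteq> \<rho>" using w dist_root by auto
  then obtain u where u: "u \<in> verts T" "adj T u w" "dist w = Suc (dist u)"
    using parent_exists w by blast
  then have "u \<in> leaves T \<rho>"
    using assms(1) w by (auto simp: perfect_tree_def)
  then show False
    using u w by (auto simp: leaves_def children_def)
qed

lemma perfect_tree_imp_rooted:
  assumes "perfect_tree T \<rho> r h"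
    and "\<And>u w. E u w \<Longrightarrow> E w u"
    and "\<And>u w. u \<in> verts T \<Longrightarrow> w \<in> verts T \<Longrightarrow> E u w \<longleftrightarrow> adj T u w"
  shows "perfect_rooted_tree E (verts T) (children T \<rho>) (\<lambda>v. h - graph_dist T \<rho> v) r"
proof -
  interpret rooted_graph_tree T \<rho>
    using assms(1) by unfold_locales (auto simp: perfect_tree_def)
  note less = perfect_tree_dist_less[OF assms(1)]
  show ?thesis
  proof
    show "finite (verts T)" using simple by (simp add: simple_graph_def)
  next
    fix u w assume "E u w" then show "E w u" by (rule assms(2))
  next
    fix u w assume "u \<in> verts T" "w \<in> verts T"
    then show "E u w \<longleftrightarrow> w \<in> children T \<rho> u \<or> u \<in> children T \<rho> w"
      using assms(3) adj_iff_children by blast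
  next
    fix u w assume "u \<in> verts T" "w \<in> children T \<rho> u"
    then show "w \<in> verts T" by (simp add: children_def)
  next
    fix u w assume "u \<in> verts T" "w \<in> children T \<rho> u"
    then show "h - dist u = Suc (h - dist w)" using less[of w] by (auto simp: children_def)
  next
    fix u u' w assume "w \<in> children T \<rho> u" "w \<in> children T \<rho> u'"
    then show "u = u'" using parent_unique by (auto simp: children_def)
  next
    fix u assume "u \<in> verts T" then show "0 < h - dist u" using less by simp
  next
    fix u assume u: "u \<in> verts T" "1 < h - dist u"
    then have "u \<notin> leaves T \<rho>" using assms(1) by (auto simp: perfect_tree_def)
    then show "card (children T \<rho> u) = r" using assms(1) u by (auto simp: perfect_tree_def)
  qed
qed

lemma perfect_tree_polys:
  assumes "perfect_tree T \<rho> r h"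
    and "\<And>u w. E u w \<Longrightarrow> E w u"
    and "\<And>u w. u \<in> verts T \<Longrightarrow> w \<in> verts T \<Longrightarrow> E u w \<longleftrightarrow> adj T u w"
  shows "indep_poly E (verts T) {} = tree_poly r h"
    and "v \<in> verts T \<Longrightarrow> indep_poly E (verts T) {v} = star_poly r (h - graph_dist T \<rho> v) h"
proof -
  interpret rooted_graph_tree T \<rho>
    using assms(1) by unfold_locales (auto simp: perfect_tree_def)
  interpret P: perfect_rooted_tree E "verts T" "children T \<rho>" "\<lambda>v. h - dist v" r
    using assms by (rule perfect_tree_imp_rooted)
  have "v \<in> P.desc \<rho>" if "v \<in> verts T" for v
    using that
  proof (induction "dist v" arbitrary: v rule: less_induct)
    case less
    show ?case
    proof (cases "v = \<rho>")
      case False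
      then obtain u where u: "u \<in> verts T" "adj T u v" "dist v = Suc (dist u)"
        using parent_exists less.prems by blast
      then have "v \<in> children T \<rho> u" using less.prems by (simp add: children_def)
      then show ?thesis using P.desc_ch[of u \<rho> v] less.hyps[of u] u by simp
    qed simp
  qed
  then have "P.desc \<rho> = verts T" using P.desc_subset[OF root] by blast
  then show "indep_poly E (verts T) {} = tree_poly r h"
    and "v \<in> verts T \<Longrightarrow> indep_poly E (verts T) {v} = star_poly r (h - dist v) h"
    using P.indep_poly_desc[OF root] P.indep_poly_desc_star[OF root, of v] dist_root by auto
qed

section \<open>Components\<close>

definition reach :: "'a sgraph \<Rightarrow> 'a \<Rightarrow> 'a \<Rightarrow> bool" where
  "reach G u v \<longleftrightarrow> (\<exists>p. walk G p \<and> hd p = u \<and> last p = v)"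

lemma graph_connected_iff_reach:
  "graph_connected G \<longleftrightarrow> verts G \<noteq> {} \<and> (\<forall>u\<in>verts G. \<forall>v\<in>verts G. reach G u v)"
  by (simp add: graph_connected_def reach_def)

lemma reach_refl: "v \<in> verts G \<Longrightarrow> reach G v v"
  unfolding reach_def by (rule exI[of _ "[v]"]) (simp add: walk_def)

lemma reach_verts: "reach G u v \<Longrightarrow> u \<in> verts G \<and> v \<in> verts G"
  unfolding reach_def walk_def by (auto dest: hd_in_set last_in_set)

lemma reach_step: "reach G u v \<Longrightarrow> adj G v w \<Longrightarrow> w \<in> verts G \<Longrightarrow> reach G u w"
  unfolding reach_def
proof (elim exE conjE)
  fix p assume "walk G p" "hd p = u" "last p = v" "adj G v w" "w \<in> verts G"
  moreover from this have "p \<noteq> []" by (auto simp: walk_def)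
  ultimately show "\<exists>p. walk G p \<and> hd p = u \<and> last p = w"
    by (intro exI[of _ "p @ [w]"]) (auto simp: walk_snoc)
qed

lemma reach_induct [consumes 1, case_names refl step]:
  assumes "reach G u v" "u \<in> verts G \<Longrightarrow> P u"
    and "\<And>x y. reach G u x \<Longrightarrow> P x \<Longrightarrow> adj G x y \<Longrightarrow> y \<in> verts G \<Longrightarrow> P y"
  shows "P v"
proof -
  obtain p where "walk G p" "hd p = u" "last p = v"
    using assms(1) by (auto simp: reach_def)
  then show ?thesis
  proof (induction p arbitrary: v rule: rev_induct)
    case Nil
    then show ?case by (simp add: walk_def)
  next
    case (snoc x p)
    show ?case
    proof (cases "p = []")
      case True
      then show ?thesis using snoc.prems assms(2) by (simp add: walk_def)
    next
      case False
      then have w: "walk G p" "hd p = u" "adj G (last p) x" "x \<in> verts G" "v = x"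
        using snoc.prems by (auto simp: walk_snoc)
      then have "reach G u (last p)" by (auto simp: reach_def)
      then show ?thesis using assms(3) snoc.IH w by blast
    qed
  qed
qed

lemma reach_trans: "reach G v w \<Longrightarrow> reach G u v \<Longrightarrow> reach G u w"
  by (induction rule: reach_induct) (auto intro: reach_step)

lemma reach_sym: "reach G u v \<Longrightarrow> reach G v u"
proof (induction rule: reach_induct)
  case refl
  then show ?case by (rule reach_refl)
next
  case (step x y)
  then have "reach G y x"
    using reach_step[OF reach_refl[of y G]] adj_sym reach_verts by metis
  then show ?case using reach_trans step by metis
qed

definition component_of :: "'a sgraph \<Rightarrow> 'a \<Rightarrow> 'a sgraph" where
  "component_of G v = SGraph {u. reach G v u} {e \<in> edges G. e \<subseteq> {u. reach G v u}}"

lemma adj_component_of: "adj (component_of G v) u w \<longleftrightarrow> adj G u w \<and> reach G v u \<and> reach G v w"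
  by (auto simp: component_of_def adj_def)

lemma verts_component_of: "verts (component_of G v) = {u. reach G v u}"
  by (simp add: component_of_def)

lemma component_of_subgraph:
  assumes "simple_graph G"
  shows "subgraph (component_of G v) G"
proof -
  have "{u. reach G v u} \<subseteq> verts G" by (auto dest: reach_verts)
  then show ?thesis
    using assms finite_subset by (auto simp: subgraph_def simple_graph_def component_of_def)
qed

lemma component_of_connected:
  assumes "v \<in> verts G"
  shows "graph_connected (component_of G v)"
proof -
  let ?C = "component_of G v"
  \<comment> \<open>A walk of \<open>G\<close> from \<open>v\<close> is rebuilt edge by edge inside
    the component.\<close>
  have from_v: "reach ?C v u" if "reach G v u" for u
    using that
  proof (induction rule: reach_induct)
    case refl
    then show ?case by (intro reach_refl) (simp add: verts_component_of reach_refl)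
  next
    case (step x y)
    then have "reach G v y" by (auto intro: reach_step)
    then show ?case
      using step by (intro reach_step[of ?C v x y]) (auto simp: adj_component_of verts_component_of)
  qed
  then have "reach ?C u w" if "reach G v u" "reach G v w" for u w
    using that reach_trans reach_sym by metis
  then show ?thesis
    using reach_refl[OF assms] by (auto simp: graph_connected_iff_reach verts_component_of)
qed

lemma connected_subgraph_component_of:
  assumes "subgraph H G" "graph_connected H" "v \<in> verts H"
  shows "subgraph H (component_of G v)"
proof -
  have "reach G v u" if "u \<in> verts H" for u
  proof -
    have "reach H v u"
      using assms(2,3) that by (simp add: graph_connected_iff_reach)
    then show ?thesis
    proof (induction rule: reach_induct)
      case refl
      then show ?case using assms(1) by (intro reach_refl) (auto simp: subgraph_def)
    next
      case (step x y)
      then show ?case using assms(1) by (intro reach_step[of G v x y]) (auto simp: subgraph_def adj_def)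
    qed
  qed
  then show ?thesis
    using assms(1) by (auto simp: subgraph_def component_of_def simple_graph_def)
qed

text \<open>\<open>component_of G v\<close> contains every connected subgraph through
  \<open>v\<close>, so the maximality of \<open>H\<close> forces equality.\<close>

lemma component_eq:
  assumes "simple_graph G" "H \<in> graph_components G" "v \<in> verts H"
  shows "H = component_of G v"
proof -
  have "subgraph H G" "graph_connected H"
    using assms(2) by (auto simp: graph_components_def)
  moreover from this have "v \<in> verts G" using assms(3) by (auto simp: subgraph_def)
  ultimately have "subgraph (component_of G v) G" "graph_connected (component_of G v)"
    "subgraph H (component_of G v)"
    using assms(1,3) by (simp_all add: component_of_subgraph component_of_connected connected_subgraph_component_of)
  then show ?thesis
    using assms(2) by (auto simp: graph_components_def)
qed

lemma component_of_in_components: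
  assumes "simple_graph G" "v \<in> verts G"
  shows "component_of G v \<in> graph_components G"
proof -
  have "H = component_of G v"
    if "subgraph H G" "graph_connected H" "subgraph (component_of G v) H" for H
  proof -
    have "v \<in> verts H"
      using that(3) reach_refl[OF assms(2)] by (auto simp: subgraph_def verts_component_of)
    then have "subgraph H (component_of G v)"
      using that by (intro connected_subgraph_component_of)
    then show ?thesis
      using that(3) by (intro sgraph.expand) (auto simp: subgraph_def)
  qed
  then show ?thesis
    using assms component_of_subgraph component_of_connected by (auto simp: graph_components_def)
qed

lemma component_adj:
  assumes "simple_graph G" "H \<in> graph_components G" "u \<in> verts H"
  shows "adj G u w \<longleftrightarrow> adj H u w" and "adj G u w \<Longrightarrow> w \<in> verts H"
proof -
  have H: "H = component_of G u" by (rule component_eq[OF assms])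
  have "reach G u u" using assms(3) unfolding H verts_component_of by (auto dest: reach_verts intro: reach_refl)
  moreover from this have "reach G u w" if "adj G u w"
    using that adj_verts[OF assms(1) that] reach_step by metis
  ultimately show "adj G u w \<longleftrightarrow> adj H u w" "adj G u w \<Longrightarrow> w \<in> verts H"
    unfolding H adj_component_of verts_component_of by auto
qed

text \<open>With one level all vertices are leaves and the arity condition is void. Hence
  single-vertex components count among those of highest arity.\<close>

lemma perfect_tree_single:
  assumes "perfect_tree T \<rho> r 1" "2 \<le> R"
  shows "perfect_tree T \<rho> R 1"
proof -
  have "verts T \<subseteq> leaves T \<rho>"
    using assms(1) perfect_tree_dist_less[OF assms(1)] by (auto simp: perfect_tree_def)
  then have no_inner: "verts T - leaves T \<rho> = {}" by blast
  show ?thesis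
    using assms unfolding perfect_tree_def no_inner by auto
qed

section \<open>The comparison in the forest\<close>

lemma card_indep_star:
  assumes "finite (verts G)"
  shows "int (card (indep_star G k v)) = coeff (indep_poly (adj G) (verts G) {v}) k"
proof -
  have "indep_star G k v = {A \<in> indep_fam (adj G) (verts G) {v}. card A = k}"
    by (auto simp: indep_star_def indep_sets_def indep_fam_def)
  then show ?thesis by (simp add: coeff_indep_poly[OF assms])
qed

theorem theorem2:
  fixes G :: "'a sgraph" and T :: "nat \<Rightarrow> 'a sgraph" and \<rho> :: "nat \<Rightarrow> 'a"
    and r h :: "nat \<Rightarrow> nat" and n m k :: nat and l v :: 'a
  assumes forest: "graph_forest G"
    and components: "bij_betw T {1..n} (graph_components G)"
    and perfect: "\<And>i. i \<in> {1..n} \<Longrightarrow> perfect_tree (T i) (\<rho> i) (r i) (h i)"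
    and highest: "{1..m} = {i \<in> {1..n}. perfect_tree (T i) (\<rho> i) (Max (r ` {1..n})) (h i)}"
    and sorted: "\<And>i j. 1 \<le> i \<Longrightarrow> i \<le> j \<Longrightarrow> j \<le> m \<Longrightarrow> h i \<le> h j"
    and leaf: "if \<forall>i \<in> {1..m}. even (h i)
               then l \<in> leaves (T m) (\<rho> m)
               else (let j = (LEAST j. j \<in> {1..m} \<and> odd (h j)) in l \<in> leaves (T j) (\<rho> j))"
    and "k > 0"
    and "v \<in> verts G"
  shows "card (indep_star G k v) \<le> card (indep_star G k l)"
proof -
  let ?I = "{1..n}"
  define R where "R = Max (r ` ?I)"
  \<comment> \<open>A single-vertex component lies in \<open>{1..m}\<close> even if its
    \<open>r i\<close> is below \<open>R\<close>; it is then read as a tree of arity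
    \<open>R\<close>.\<close>
  define arity where "arity i = (if i \<in> {1..m} then R else r i)" for i
  have simple: "simple_graph G" using forest by (simp add: graph_forest_def)
  then have fin: "finite (verts G)" by (simp add: simple_graph_def)
  have comp: "T i \<in> graph_components G" if "i \<in> ?I" for i
    using components that by (auto simp: bij_betw_def)
  have verts_T: "verts (T i) \<subseteq> verts G" if "i \<in> ?I" for i
    using comp[OF that] by (auto simp: graph_components_def subgraph_def)
  have ex_comp: "\<exists>i\<in>?I. u \<in> verts (T i)" if "u \<in> verts G" for u
  proof -
    have "component_of G u \<in> T ` ?I"
      using component_of_in_components[OF simple that] components by (simp add: bij_betw_def)
    moreover have "u \<in> verts (component_of G u)"
      using that by (simp add: verts_component_of reach_refl)
    ultimately show ?thesis by auto
  qed
  have verts_G: "verts G = (\<Union>i\<in>?I. verts (T i))"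
    using ex_comp verts_T by blast
  have inj: "i = j" if "i \<in> ?I" "j \<in> ?I" "u \<in> verts (T i)" "u \<in> verts (T j)" for i j u
  proof -
    have "T i = T j" using that component_eq[OF simple comp] by metis
    then show ?thesis using that components inj_onD[of T ?I i j] by (simp add: bij_betw_def)
  qed
  have disj: "disjoint_family_on (\<lambda>i. verts (T i)) ?I"
    unfolding disjoint_family_on_def using inj by blast
  have no_edge: "\<not> adj G u w"
    if "i \<in> ?I" "j \<in> ?I" "i \<noteq> j" "u \<in> verts (T i)" "w \<in> verts (T j)" for i j u w
    using that component_adj(2)[OF simple comp] inj by metis
  have fin_T: "finite (verts (T i))" if "i \<in> ?I" for i
    using verts_T[OF that] fin finite_subset by blast

  have r_le: "r i \<le> R" "2 \<le> r i" "1 \<le> h i" if "i \<in> ?I" for i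
    using that perfect[OF that] by (auto simp: R_def perfect_tree_def)
  have m_iff: "i \<in> {1..m} \<longleftrightarrow> i \<in> ?I \<and> perfect_tree (T i) (\<rho> i) R (h i)" for i
    unfolding highest R_def by blast
  then have mI: "i \<in> ?I" "perfect_tree (T i) (\<rho> i) R (h i)" if "i \<in> {1..m}" for i
    using that by blast+
  have inm: "i \<in> {1..m}" if "i \<in> ?I" "perfect_tree (T i) (\<rho> i) R (h i)" for i
    using that m_iff by blast
  have perfect': "perfect_tree (T i) (\<rho> i) (arity i) (h i)" if "i \<in> ?I" for i
    using perfect[OF that] mI by (simp add: arity_def)
  have arity_pos: "0 < arity i" if "i \<in> ?I" for i
    using perfect'[OF that] by (simp add: perfect_tree_def)

  obtain a where a: "a \<in> ?I" "v \<in> verts (T a)" using ex_comp assms(8) by blast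
  \<comment> \<open>Since \<open>v\<close> lies in some component, the maximum is attained, and so
    \<open>{1..m}\<close> is not empty.\<close>
  have "R \<in> r ` ?I" unfolding R_def using a by (intro Max_in) auto
  then obtain i0 where "i0 \<in> ?I" "r i0 = R" by auto
  then have "i0 \<in> {1..m}" using inm perfect by metis
  then have m1: "m \<in> {1..m}" by simp

  \<comment> \<open>\<open>b\<close> is the component of \<open>l\<close>. \<open>best\<close> is
    the cross-multiplied form of the claim that its ratio of leaf star to all independent sets is
    largest within arity \<open>R\<close>.\<close>
  obtain b where b: "b \<in> {1..m}" "l \<in> leaves (T b) (\<rho> b)"
    and best: "\<And>i. i \<in> {1..m} \<Longrightarrow>
      star_poly R 1 (h i) * tree_poly R (h b) \<preceq> star_poly R 1 (h b) * tree_poly R (h i)"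
  proof (cases "\<forall>i\<in>{1..m}. even (h i)")
    case True
    have "star_poly R 1 (h i) * tree_poly R (h m) \<preceq> star_poly R 1 (h m) * tree_poly R (h i)"
      if "i \<in> {1..m}" for i
    proof (cases "h i = h m")
      case False
      then have "h i < h m" using sorted[of i m] that by auto
      then show ?thesis
        using star_tree_same_arity[of R "h i" "h m"] True that r_le mI(1) by fastforce
    qed simp
    then show ?thesis using that[of m] m1 leaf True by simp
  next
    case False
    define j where "j = (LEAST j. j \<in> {1..m} \<and> odd (h j))"
    have j: "j \<in> {1..m}" "odd (h j)"
      using False LeastI_ex[of "\<lambda>j. j \<in> {1..m} \<and> odd (h j)"] unfolding j_def by blast+
    have j_le: "j \<le> i" if "i \<in> {1..m}" "odd (h i)" for i
      unfolding j_def using that by (intro Least_le) auto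
    have "0 < R" using r_le mI(1)[OF j(1)] by fastforce
    have "star_poly R 1 (h i) * tree_poly R (h j) \<preceq> star_poly R 1 (h j) * tree_poly R (h i)"
      if i: "i \<in> {1..m}" for i
    proof -
      \<comment> \<open>A tree shorter than \<open>T j\<close> has an index below \<open>j\<close>,
        so its height is even by minimality of \<open>j\<close>. Odd heights win against larger
        ones, even heights lose to larger ones.\<close>
      consider "h i = h j" | "h j < h i" | "h i < h j" "even (h i)"
        using j_le[OF i] sorted[of j i] j i by force
      then show ?thesis
      proof cases
        case 2
        then show ?thesis using star_tree_same_arity[OF \<open>0 < R\<close> 2] j by simp
      next
        case 3
        then show ?thesis using star_tree_same_arity[OF \<open>0 < R\<close> 3(1)] by simp
      qed simp
    qed
    moreover have "l \<in> leaves (T j) (\<rho> j)"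
      using leaf unfolding if_not_P[OF False] Let_def j_def .
    ultimately show ?thesis using that[of j] j(1) by blast
  qed
  have bI: "b \<in> ?I" using mI b by blast
  have l: "l \<in> verts (T b)" "h b - graph_dist (T b) (\<rho> b) l = 1"
    using b(2) perfect[OF bI] by (auto simp: perfect_tree_def)

  have tree_T: "indep_poly (adj G) (verts (T i)) {} = tree_poly (arity i) (h i)" if "i \<in> ?I" for i
    using perfect'[OF that] adj_sym component_adj(1)[OF simple comp[OF that]]
    by (intro perfect_tree_polys(1)) auto
  have star_T: "indep_poly (adj G) (verts (T i)) {u}
      = star_poly (arity i) (h i - graph_dist (T i) (\<rho> i) u) (h i)"
    if "i \<in> ?I" "u \<in> verts (T i)" for i u
    using perfect'[OF that(1)] adj_sym component_adj(1)[OF simple comp[OF that(1)]] that(2)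
    by (intro perfect_tree_polys(2)) auto
  define rest where "rest J = (\<Prod>j\<in>J. tree_poly (arity j) (h j))" for J
  have rest_nonneg: "cnonneg (rest J)" for J
    by (simp add: rest_def cnonneg_prod)
  have star_G: "indep_poly (adj G) (verts G) {u}
      = star_poly (arity i) (h i - graph_dist (T i) (\<rho> i) u) (h i) * rest (?I - {i})"
    if "i \<in> ?I" "u \<in> verts (T i)" for i u
  proof -
    have "indep_poly (adj G) (verts G) {u}
        = indep_poly (adj G) (verts (T i)) {u} * (\<Prod>j\<in>?I - {i}. indep_poly (adj G) (verts (T j)) {})"
      unfolding verts_G by (rule indep_poly_UN_star) (use fin_T disj no_edge that in auto)
    then show ?thesis using star_T that tree_T by (simp add: rest_def)
  qed
  have below: "star_poly (arity a) (h a - graph_dist (T a) (\<rho> a) v) (h a) \<preceq> star_poly (arity a) 1 (h a)"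
    using perfect_tree_dist_less[OF perfect'[OF a(1)] a(2)] arity_pos[OF a(1)]
    by (intro star_cle_leaf) auto
  \<comment> \<open>First \<open>v\<close> is replaced by a leaf of its own component
    \<open>a\<close>, then that leaf by the leaf \<open>l\<close> of component
    \<open>b\<close>.\<close>
  have "indep_poly (adj G) (verts G) {v} \<preceq> star_poly (arity a) 1 (h a) * rest (?I - {a})"
    unfolding star_G[OF a] using below rest_nonneg by (intro cle_mult) auto
  also have "\<dots> \<preceq> star_poly (arity b) 1 (h b) * rest (?I - {b})"
  proof (cases "a = b")
    case False
    \<comment> \<open>The components other than \<open>a\<close> and \<open>b\<close> contribute the
      common factor \<open>rest ?J\<close>; what remains is a comparison of cross products.\<close>
    let ?J = "?I - {a} - {b}"
    have rest_a: "rest (?I - {a}) = tree_poly (arity b) (h b) * rest ?J"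
      unfolding rest_def using bI False by (intro prod.remove) auto
    have "rest (?I - {b}) = tree_poly (arity a) (h a) * rest (?I - {b} - {a})"
      unfolding rest_def using a False by (intro prod.remove) auto
    also have "?I - {b} - {a} = ?J" by blast
    finally have rest_b: "rest (?I - {b}) = tree_poly (arity a) (h a) * rest ?J" .
    have "star_poly (arity a) 1 (h a) * tree_poly (arity b) (h b)
        \<preceq> star_poly (arity b) 1 (h b) * tree_poly (arity a) (h a)"
    proof (cases "a \<in> {1..m}")
      case True
      then show ?thesis using best[OF True] b(1) by (simp add: arity_def)
    next
      case a_low: False
      then have "r a \<noteq> R" using inm perfect a(1) by metis
      then have "r a < R" using r_le(1)[OF a(1)] by simp
      \<comment> \<open>A single vertex would have arity \<open>R\<close> as well, and
        \<open>a\<close> would lie in \<open>{1..m}\<close>.\<close>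
      moreover have "h a \<noteq> 1"
        using perfect_tree_single[of "T a" "\<rho> a" "r a" R] perfect[OF a(1)] r_le[OF a(1)] inm[OF a(1)] a_low
        by fastforce
      then have "2 \<le> h a" using r_le(3)[OF a(1)] by simp
      ultimately show ?thesis
        using star_tree_less_arity[of "r a" R "h a" "h b"] r_le[OF a(1)] r_le[OF bI] a_low b(1)
        by (auto simp: arity_def)
    qed
    then show ?thesis
      unfolding rest_a rest_b mult.assoc[symmetric] by (rule cle_mult[OF _ cle_refl]) (simp_all add: rest_nonneg)
  qed simp
  also have "\<dots> = indep_poly (adj G) (verts G) {l}"
    using star_G[OF bI l(1)] l(2) by simp
  finally have "int (card (indep_star G k v)) \<le> int (card (indep_star G k l))"
    unfolding card_indep_star[OF fin] by (rule cle_coeff)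
  then show ?thesis by simp
qed

end
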